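(* Let $d\ge1$ be an integer, $\Phi=\mathrm{Re}(z^d)$, and let $(u,v)$ be a solution of $$\Delta u=uv^2,\qquad \Delta v=vu^2,\qquad u>0,\ v>0\qquad\text{in }\mathbb{R}^2$$ satisfying: 1. $u-v>0$ in $\{\Phi>0\}$ and $u-v<0$ in $\{\Phi<0\}$; 2. $u\ge\Phi^+$ and $v\ge\Phi^-$; 3. $u(T_iz)=v(z)$ for all $z$ and all $i=1,\dots,d$; 4. $N(r)\le d$ for all $r>0$; 5. $\lim_{r\to+\infty}N(r)=d$. Then, as $R\to+\infty$, $$\left(\frac{1}{R^d}u(Rx),\ \frac{1}{R^d}v(Rx)\right)$$ converges uniformly on compact subsets of $\mathbb{R}^2$ to a multiple of $(\Phi^+,\Phi^-)$.
   Context: $\mathbb{R}^2$ is identified with $\mathbb{C}$. The zero set of $\Phi(z)=\mathrm{Re}(z^d)$ consists of $d$ lines $L_1,\dots,L_d$ through the origin, and $T_i$ is the reflection with respect to $L_i$. $\Phi^+=\max(\Phi,0)$, $\Phi^-=\max(-\Phi,0)$. The Almgren frequency function is $$N(r):=\frac{r\int_{B_r(0)}\left(|\nabla u|^2+|\nabla v|^2+u^2v^2\right)}{\int_{\partial B_r(0)}(u^2+v^2)} .$$ *)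

theory Defs
  imports "HOL-Analysis.Analysis"
begin

text \<open>The plane is identified with \<^typ>\<open>complex\<close>, whose \<^const>\<open>Basis\<close> is \<open>{1, \<i>}\<close>. The value of
  \<^const>\<open>frechet_derivative\<close> is unspecified at points where the function is not differentiable, so
  the operators below are meaningful only for functions of the regularity required by \<open>C2\<close>.\<close>

definition partial_deriv :: "'a::euclidean_space \<Rightarrow> ('a \<Rightarrow> real) \<Rightarrow> 'a \<Rightarrow> real" where
  "partial_deriv b f x = frechet_derivative f (at x) b"

definition grad :: "('a::euclidean_space \<Rightarrow> real) \<Rightarrow> 'a \<Rightarrow> 'a" where
  "grad f x = (\<Sum>b\<in>Basis. partial_deriv b f x *\<^sub>R b)"

definition laplacian :: "('a::euclidean_space \<Rightarrow> real) \<Rightarrow> 'a \<Rightarrow> real" where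
  "laplacian f x = (\<Sum>b\<in>Basis. partial_deriv b (partial_deriv b f) x)"

definition C2 :: "('a::euclidean_space \<Rightarrow> real) \<Rightarrow> bool" where
  "C2 f \<longleftrightarrow> (\<forall>x. f differentiable (at x)) \<and>
     (\<forall>b\<in>Basis. (\<forall>x. partial_deriv b f differentiable (at x)) \<and>
       (\<forall>c\<in>Basis. continuous_on UNIV (partial_deriv c (partial_deriv b f))))"

definition positive_solution :: "(complex \<Rightarrow> real) \<Rightarrow> (complex \<Rightarrow> real) \<Rightarrow> bool" where
  "positive_solution u v \<longleftrightarrow> C2 u \<and> C2 v \<and>
     (\<forall>z. laplacian u z = u z * (v z)\<^sup>2 \<and> laplacian v z = v z * (u z)\<^sup>2 \<and> u z > 0 \<and> v z > 0)"

definition \<Phi> :: "nat \<Rightarrow> complex \<Rightarrow> real" where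
  "\<Phi> d z = Re (z ^ d)"

definition \<Phi>_pos :: "nat \<Rightarrow> complex \<Rightarrow> real" where
  "\<Phi>_pos d z = max (\<Phi> d z) 0"

definition \<Phi>_neg :: "nat \<Rightarrow> complex \<Rightarrow> real" where
  "\<Phi>_neg d z = max (- \<Phi> d z) 0"

text \<open>The lines \<open>L\<^sub>1, \<dots>, L\<^sub>d\<close> are given as a set rather than as an indexed family; the lemmas
  \<open>Union_nodal_lines\<close> and \<open>card_nodal_lines\<close> below show that their union is the zero set of
  \<^term>\<open>\<Phi> d\<close> and that there are exactly \<open>d\<close> of them.\<close>

definition nodal_lines :: "nat \<Rightarrow> complex set set" where
  "nodal_lines d = {L. subspace L \<and> dim L = 1 \<and> L \<subseteq> {z. \<Phi> d z = 0}}"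

text \<open>For a line through the origin, \<^const>\<open>closest_point\<close> is the orthogonal projection onto it.\<close>

definition reflection :: "complex set \<Rightarrow> complex \<Rightarrow> complex" where
  "reflection L z = 2 *\<^sub>R closest_point L z - z"

text \<open>The integral over \<open>\<partial>B\<^sub>r(0)\<close> with respect to arc length, which is \<open>r d\<theta>\<close>.\<close>

definition circle_integral :: "real \<Rightarrow> (complex \<Rightarrow> real) \<Rightarrow> real" where
  "circle_integral r f = integral {0..2 * pi} (\<lambda>\<theta>. f (rcis r \<theta>) * r)"

definition almgren :: "(complex \<Rightarrow> real) \<Rightarrow> (complex \<Rightarrow> real) \<Rightarrow> real \<Rightarrow> real" where
  "almgren u v r =
     r * (LINT z:ball 0 r|lborel. (norm (grad u z))\<^sup>2 + (norm (grad v z))\<^sup>2 + (u z)\<^sup>2 * (v z)\<^sup>2)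
       / circle_integral r (\<lambda>z. (u z)\<^sup>2 + (v z)\<^sup>2)"

lemma nodal_line_through:
  assumes "\<Phi> d w = 0" "d \<ge> 1" "w \<noteq> 0"
  shows "span {w} \<in> nodal_lines d"
proof -
  have "\<Phi> d z = 0" if "z \<in> span {w}" for z
  proof -
    from that obtain k where "z = k *\<^sub>R w" by (auto simp: span_singleton)
    then have "z ^ d = (k ^ d) *\<^sub>R (w ^ d)"
      by (simp add: scaleR_conv_of_real power_mult_distrib)
    then show ?thesis using assms(1) by (simp add: \<Phi>_def)
  qed
  then show ?thesis using assms(3) by (auto simp: nodal_lines_def)
qed

lemma Union_nodal_lines:
  assumes "d \<ge> 1"
  shows "\<Union> (nodal_lines d) = {z. \<Phi> d z = 0}"
proof (intro equalityI subsetI)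
  fix z assume "z \<in> {z. \<Phi> d z = 0}"
  then have z: "\<Phi> d z = 0" by simp
  then have "\<Phi> d (cis (pi / (2 * d))) = 0"
    using assms unfolding \<Phi>_def Complex.DeMoivre by simp
  then have *: "span {cis (pi / (2 * d))} \<in> nodal_lines d"
    using assms by (intro nodal_line_through) auto
  show "z \<in> \<Union> (nodal_lines d)"
  proof (cases "z = 0")
    case True
    then show ?thesis using * span_0 by blast
  next
    case False
    then show ?thesis using nodal_line_through[OF z assms] span_base[of z "{z}"] by blast
  qed
qed (auto simp: nodal_lines_def)

lemma nodal_lines_eq:
  assumes "d \<ge> 1"
  shows "nodal_lines d = (\<lambda>k. span {cis ((2 * real k + 1) * pi / (2 * d))}) ` {..<d}"
proof (intro equalityI subsetI)
  fix L assume "L \<in> nodal_lines d"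
  then have L: "subspace L" "dim L = 1" and L0: "\<And>z. z \<in> L \<Longrightarrow> \<Phi> d z = 0"
    by (auto simp: nodal_lines_def)
  obtain w where w: "w \<in> L" "w \<noteq> 0"
    using L(2) by (metis dim_eq_0 subsetI singletonI zero_neq_one)
  have wA: "w = of_real (norm w) * cis (Arg w)"
    using rcis_cmod_Arg[of w] by (simp add: rcis_def)
  then have "w ^ d = of_real (norm w ^ d) * cis (d * Arg w)"
    by (metis Complex.DeMoivre of_real_power power_mult_distrib)
  then have "cos (d * Arg w) = 0"
    using L0[OF w(1)] w(2) by (simp add: \<Phi>_def flip: of_real_power)
  then obtain m :: int where m: "odd m" "d * Arg w = m * (pi / 2)"
    unfolding cos_zero_iff_int by blast
  then obtain j where j: "m = 2 * j + 1" by (elim oddE)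
  define k where "k = nat (j mod d)"
  define q where "q = j div d"
  have kd: "k < d" and "int k = j mod d"
    using assms by (auto simp: k_def nat_less_iff)
  then have jq: "j = q * d + int k" unfolding q_def by simp
  define a where "a = (2 * real k + 1) * pi / (2 * d)"
  have "d * Arg w = (2 * (q * d + real k) + 1) * (pi / 2)"
    using m(2) j jq by simp
  then have "Arg w = a + pi * q"
    using assms by (simp add: a_def field_simps)
  then have "cis (Arg w) = cis a * cis (pi * q)"
    by (simp add: cis_mult)
  moreover have "cis (pi * q) = of_real (cos (pi * q))"
    by (simp add: complex_eq_iff)
  ultimately have "w = (norm w * cos (pi * q)) *\<^sub>R cis a"
    using wA by (simp add: scaleR_conv_of_real mult_ac)
  then have ws: "w \<in> span {cis a}" by (metis span_base span_scale singletonI)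
  have "independent {w}" using w(2) by simp
  then have "L \<subseteq> span {w}"
    using w(1) L(2) by (intro card_ge_dim_independent) simp_all
  also have "\<dots> \<subseteq> span {cis a}"
    using ws by (simp add: span_minimal)
  finally have sub: "L \<subseteq> span {cis a}" .
  have "dim (span {cis a}) \<le> 1"
    by (simp only: dim_span) (rule order_trans[OF dim_le_card'], simp_all)
  then have "L = span {cis a}"
    using L sub by (intro subspace_dim_equal) simp_all
  then show "L \<in> (\<lambda>k. span {cis ((2 * real k + 1) * pi / (2 * d))}) ` {..<d}"
    using kd unfolding a_def by blast
next
  fix L assume "L \<in> (\<lambda>k. span {cis ((2 * real k + 1) * pi / (2 * d))}) ` {..<d}"
  then obtain k where k: "k < d" "L = span {cis ((2 * real k + 1) * pi / (2 * d))}" by blast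
  have "cos ((2 * real k + 1) * (pi / 2)) = 0"
    unfolding cos_zero_iff_int by (rule exI[of _ "2 * int k + 1"]) simp
  then have "\<Phi> d (cis ((2 * real k + 1) * pi / (2 * d))) = 0"
    using assms unfolding \<Phi>_def Complex.DeMoivre by simp
  then show "L \<in> nodal_lines d"
    unfolding k(2) using assms by (intro nodal_line_through) auto
qed

lemma card_nodal_lines:
  assumes "d \<ge> 1"
  shows "card (nodal_lines d) = d"
proof -
  have "inj_on (\<lambda>k. span {cis ((2 * real k + 1) * pi / (2 * d))}) {..<d}"
  proof (rule linorder_inj_onI')
    fix i j assume ij: "i \<in> {..<d}" "j \<in> {..<d}" "i < j"
    define a b where "a = (2 * real i + 1) * pi / (2 * d)" and "b = (2 * real j + 1) * pi / (2 * d)"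
    have ba: "b - a = (real j - real i) / d * pi"
      using assms by (simp add: a_def b_def field_simps)
    have "0 < (real j - real i) / d" "(real j - real i) / d < 1"
      using ij by auto
    then have "0 < b - a" "b - a < pi"
      unfolding ba using mult_strict_right_mono[OF _ pi_gt_zero, of _ 1] by (metis mult_pos_pos pi_gt_zero, metis mult_1)
    then have s: "sin (b - a) > 0" by (rule sin_gt_zero)
    have "cis b \<notin> span {cis a}"
    proof
      assume "cis b \<in> span {cis a}"
      then obtain t where "cis b = t *\<^sub>R cis a" by (auto simp: span_singleton)
      then have "cos b = t * cos a" "sin b = t * sin a" by (auto simp: complex_eq_iff)
      then have "sin (b - a) = 0" by (simp add: sin_diff)
      with s show False by simp
    qed
    moreover have "cis b \<in> span {cis b}" by (rule span_base) simp
    ultimately show "span {cis ((2 * real i + 1) * pi / (2 * d))} \<noteq>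
        span {cis ((2 * real j + 1) * pi / (2 * d))}"
      unfolding a_def b_def by metis
  qed
  then show ?thesis by (simp add: nodal_lines_eq[OF assms] card_image)
qed

lemma reflection_span:
  assumes "w \<noteq> 0"
  shows "reflection (span {w}) z = (2 * (z \<bullet> w) / (w \<bullet> w)) *\<^sub>R w - z"
proof -
  define p where "p = ((z \<bullet> w) / (w \<bullet> w)) *\<^sub>R w"
  have p: "p \<in> span {w}" unfolding p_def by (intro span_scale span_base) simp
  have "dist z p \<le> dist z y" if "y \<in> span {w}" for y
  proof -
    from that obtain t where y: "y = t *\<^sub>R w" by (auto simp: span_singleton)
    have "orthogonal (z - p) (p - y)"
      using assms by (simp add: orthogonal_def p_def y inner_simps)
    then have "(norm ((z - p) + (p - y)))\<^sup>2 = (norm (z - p))\<^sup>2 + (norm (p - y))\<^sup>2"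
      by (rule norm_add_Pythagorean)
    then have "(norm (z - p))\<^sup>2 \<le> (norm (z - y))\<^sup>2" by simp
    then show ?thesis by (simp add: dist_norm)
  qed
  then have pc: "p = closest_point (span {w}) z"
    by (intro closest_point_unique p)
      (auto simp: subspace_imp_convex closed_span)
  then show ?thesis by (simp add: reflection_def p_def flip: pc)
qed

end

theory Submission
  imports Defs "HOL-Computational_Algebra.Polynomial"
begin

text \<open>Put \<open>w = u - v\<close> and describe points by coordinates \<open>(r, \<beta>)\<close> with \<open>\<i> z\<^sup>d = r\<^sup>d e\<^sup>i\<^sup>\<beta>\<close>. Then
  \<open>\<Phi> = r\<^sup>d sin \<beta>\<close>, and the reflection symmetry says that \<open>u\<close> and \<open>v\<close> are \<open>2 * pi\<close>-periodic in
  \<open>\<beta>\<close> with \<open>v(r, \<beta>) = u(r, -\<beta>)\<close>. The argument rests on three estimates.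

  First, \<open>\<Delta>w = - u v w\<close>, so where \<open>\<Phi> > 0\<close> the function \<open>w\<close> is positive and superharmonic, and it
  vanishes on the nodal lines. It therefore dominates the harmonic function with the same values on
  the circle of radius \<open>R\<close> (\<open>harmonic_minorant\<close>). The first sine mode of that function is homogeneous
  of degree \<open>d\<close> and the higher modes are negligible far inside. Consequently the normalised mode
  \<open>slope R = (2 / pi) R\<^sup>-\<^sup>d \<integral> w sin \<beta> d\<beta>\<close> decreases to a limit \<open>c\<close>, and \<open>w \<ge> c \<Phi>\<close> where
  \<open>\<Phi> > 0\<close> (\<open>w_ge_slope_limit\<close>). Since \<open>w - c \<Phi>\<close> has a sign, convergence of the slope is convergence
  in \<open>L\<^sup>1\<close> with weight \<open>sin \<beta>\<close>.

  Second, where \<open>\<Phi> > 0\<close> we have \<open>\<Delta>v = v u\<^sup>2 \<ge> v\<^sup>3\<close>, so the Keller-Osserman estimate bounds the smaller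
  component by a constant over the distance to the nodal lines, whatever the size of \<open>u\<close>
  (\<open>v_decay\<close>).

  Third, the value of a subharmonic function inside a disc is bounded by its \<open>L\<^sup>1\<close> norm on the boundary
  circle (\<open>subharmonic_le_integral\<close>). The first two estimates control \<open>u\<close> on circles except
  near the nodal lines; absorbing the strips there at a point where a weighted \<open>u\<close> is maximal gives
  \<open>u = O(r\<^sup>d)\<close> (\<open>u_growth\<close>). With this bound the convergence of \<open>u / r\<^sup>d\<close> to \<open>c max 0 (sin \<beta>)\<close> holds in
  unweighted \<open>L\<^sup>1\<close> on circles (\<open>defect_small\<close>), and the third estimate, applied to \<open>u\<close> minus a
  harmonic extension of the profile, turns it into a uniform upper bound (\<open>u_le_limit\<close>). The
  matching lower bound is \<open>u \<ge> w \<ge> c \<Phi>\<close>, and the statement for \<open>v\<close> follows by reflection.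

  Harmonic functions enter only as real parts of polynomials: continuous boundary values are
  approximated by trigonometric polynomials, whose harmonic extension is explicit.\<close>

section \<open>Laplacians along coordinate slices and the maximum principle\<close>

text \<open>The maximum principle only sees second derivatives along the two coordinate lines through a point.
  Recording them as derivatives of one-variable functions lets solutions, harmonic polynomials and
  explicit barriers be treated alike, without iterated Frechet derivatives. The first derivative is
  required only near \<open>0\<close>, since barriers may blow up elsewhere on the line.\<close>

definition slice_deriv2 :: "(complex \<Rightarrow> real) \<Rightarrow> complex \<Rightarrow> complex \<Rightarrow> real \<Rightarrow> bool" where
  "slice_deriv2 f b x D \<longleftrightarrow>
     (\<exists>g. (\<forall>\<^sub>F t in nhds 0. ((\<lambda>t. f (x + t *\<^sub>R b)) has_real_derivative g t) (at t)) \<and>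
          (g has_real_derivative D) (at 0))"

definition has_laplacian :: "(complex \<Rightarrow> real) \<Rightarrow> real \<Rightarrow> complex \<Rightarrow> bool" where
  "has_laplacian f L x \<longleftrightarrow>
     (\<exists>D E. slice_deriv2 f 1 x D \<and> slice_deriv2 f \<i> x E \<and> L = D + E)"

lemma has_laplacianI:
  "slice_deriv2 f 1 x D \<Longrightarrow> slice_deriv2 f \<i> x E \<Longrightarrow> L = D + E \<Longrightarrow> has_laplacian f L x"
  unfolding has_laplacian_def by blast

lemma slice_deriv2I:
  assumes "\<And>t. ((\<lambda>t. f (x + t *\<^sub>R b)) has_real_derivative g t) (at t)"
    and "(g has_real_derivative D) (at 0)"
  shows "slice_deriv2 f b x D"
  unfolding slice_deriv2_def using assms by (intro exI[of _ g]) simp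

lemma slice_deriv2_add:
  assumes "slice_deriv2 f b x D" "slice_deriv2 h b x E"
  shows "slice_deriv2 (\<lambda>y. f y + h y) b x (D + E)"
proof -
  from assms obtain g k
    where g: "\<forall>\<^sub>F t in nhds 0. ((\<lambda>t. f (x + t *\<^sub>R b)) has_real_derivative g t) (at t)"
      "(g has_real_derivative D) (at 0)"
      and k: "\<forall>\<^sub>F t in nhds 0. ((\<lambda>t. h (x + t *\<^sub>R b)) has_real_derivative k t) (at t)"
      "(k has_real_derivative E) (at 0)"
    unfolding slice_deriv2_def by blast
  have "\<forall>\<^sub>F t in nhds 0. ((\<lambda>t. f (x + t *\<^sub>R b) + h (x + t *\<^sub>R b)) has_real_derivative (g t + k t)) (at t)"
    using g(1) k(1) by eventually_elim (rule DERIV_add)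
  moreover have "((\<lambda>t. g t + k t) has_real_derivative (D + E)) (at 0)"
    using g(2) k(2) by (rule DERIV_add)
  ultimately show ?thesis unfolding slice_deriv2_def by (intro exI[of _ "\<lambda>t. g t + k t"]) simp
qed

lemma slice_deriv2_cmult:
  assumes "slice_deriv2 f b x D"
  shows "slice_deriv2 (\<lambda>y. a * f y) b x (a * D)"
proof -
  from assms obtain g
    where g: "\<forall>\<^sub>F t in nhds 0. ((\<lambda>t. f (x + t *\<^sub>R b)) has_real_derivative g t) (at t)"
      "(g has_real_derivative D) (at 0)"
    unfolding slice_deriv2_def by blast
  have "\<forall>\<^sub>F t in nhds 0. ((\<lambda>t. a * f (x + t *\<^sub>R b)) has_real_derivative (a * g t)) (at t)"
    using g(1) by eventually_elim (rule DERIV_cmult)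
  moreover have "((\<lambda>t. a * g t) has_real_derivative (a * D)) (at 0)"
    using g(2) by (rule DERIV_cmult)
  ultimately show ?thesis unfolding slice_deriv2_def by (intro exI[of _ "\<lambda>t. a * g t"]) simp
qed

lemma has_laplacian_add:
  assumes "has_laplacian f L x" "has_laplacian g M x"
  shows "has_laplacian (\<lambda>y. f y + g y) (L + M) x"
proof -
  from assms obtain D E D' E' where "slice_deriv2 f 1 x D" "slice_deriv2 f \<i> x E" "L = D + E"
    "slice_deriv2 g 1 x D'" "slice_deriv2 g \<i> x E'" "M = D' + E'"
    unfolding has_laplacian_def by blast
  then show ?thesis unfolding has_laplacian_def
    by (intro exI[of _ "D + D'"] exI[of _ "E + E'"]) (simp add: slice_deriv2_add)
qed

lemma has_laplacian_cmult:
  assumes "has_laplacian f L x"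
  shows "has_laplacian (\<lambda>y. a * f y) (a * L) x"
proof -
  from assms obtain D E where "slice_deriv2 f 1 x D" "slice_deriv2 f \<i> x E" "L = D + E"
    unfolding has_laplacian_def by blast
  then show ?thesis unfolding has_laplacian_def
    by (intro exI[of _ "a * D"] exI[of _ "a * E"]) (simp add: slice_deriv2_cmult distrib_left)
qed

lemma has_laplacian_diff:
  assumes "has_laplacian f L x" "has_laplacian g M x"
  shows "has_laplacian (\<lambda>y. f y - g y) (L - M) x"
  using has_laplacian_add[OF assms(1) has_laplacian_cmult[OF assms(2), of "-1"]] by simp

lemma has_laplacian_const: "has_laplacian (\<lambda>y. a) 0 x"
  unfolding has_laplacian_def
  by (intro exI[of _ 0] conjI slice_deriv2I[where g = "\<lambda>_. 0"]) auto

text \<open>Restricting a differentiable function to the line \<open>t \<mapsto> x + t b\<close> turns its partial derivative in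
  direction \<open>b\<close> into an ordinary derivative; this is done twice.\<close>

lemma has_laplacian_C2:
  assumes "C2 f"
  shows "has_laplacian f (laplacian f x) x"
proof -
  have line: "((\<lambda>t. h (x + t *\<^sub>R b)) has_real_derivative partial_deriv b h (x + t *\<^sub>R b)) (at t)"
    if "h differentiable (at (x + t *\<^sub>R b))" for h :: "complex \<Rightarrow> real" and b t
  proof -
    have D: "(h has_derivative frechet_derivative h (at (x + t *\<^sub>R b))) (at (x + t *\<^sub>R b))"
      using that by (simp add: frechet_derivative_works)
    have "((\<lambda>t. x + t *\<^sub>R b) has_derivative (\<lambda>s. s *\<^sub>R b)) (at t)"
      by (auto intro!: derivative_eq_intros)
    then have "((\<lambda>t. h (x + t *\<^sub>R b)) has_derivative (\<lambda>s. frechet_derivative h (at (x + t *\<^sub>R b)) (s *\<^sub>R b))) (at t)"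
      using D by (rule has_derivative_compose)
    moreover have "frechet_derivative h (at (x + t *\<^sub>R b)) (s *\<^sub>R b) = partial_deriv b h (x + t *\<^sub>R b) * s" for s
      using linear_frechet_derivative[OF that] by (simp add: linear_cmul partial_deriv_def)
    ultimately show ?thesis by (simp add: has_field_derivative_def)
  qed
  have "slice_deriv2 f b x (partial_deriv b (partial_deriv b f) x)" if "b \<in> Basis" for b
    using that assms line[of "partial_deriv b f" 0 b]
    by (intro slice_deriv2I[where g = "\<lambda>t. partial_deriv b f (x + t *\<^sub>R b)"] line) (auto simp: C2_def)
  then show ?thesis
    unfolding has_laplacian_def
    by (intro exI[of _ "partial_deriv 1 (partial_deriv 1 f) x"]
        exI[of _ "partial_deriv \<i> (partial_deriv \<i> f) x"]) (simp add: laplacian_def Basis_complex_def)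
qed

text \<open>For holomorphic \<open>f\<close> the second derivatives of \<open>Re f\<close> along \<open>1\<close> and \<open>\<i>\<close> are \<open>Re f''\<close> and
  \<open>Re (\<i>\<^sup>2 f'')\<close>, which cancel.\<close>

lemma has_laplacian_Re_poly: "has_laplacian (\<lambda>z. Re (poly p z)) 0 x"
proof -
  have D: "((\<lambda>t. Re (a * poly q (x + t *\<^sub>R b))) has_real_derivative Re (a * b * poly (pderiv q) (x + t *\<^sub>R b))) (at t)"
    for a b q and t :: real
  proof -
    have "((\<lambda>z. a * poly q z) has_field_derivative a * poly (pderiv q) (x + t *\<^sub>R b)) (at (x + t *\<^sub>R b))"
      by (intro DERIV_cmult poly_DERIV)
    moreover have "((\<lambda>t. x + t *\<^sub>R b) has_vector_derivative b) (at t)"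
      by (auto intro!: derivative_eq_intros)
    ultimately have "((\<lambda>t. a * poly q (x + t *\<^sub>R b)) has_vector_derivative b * (a * poly (pderiv q) (x + t *\<^sub>R b))) (at t)"
      using field_vector_diff_chain_at[of "\<lambda>t. x + t *\<^sub>R b" b t "\<lambda>z. a * poly q z"] by (simp add: o_def)
    then have "((\<lambda>t. Re (a * poly q (x + t *\<^sub>R b))) has_vector_derivative Re (b * (a * poly (pderiv q) (x + t *\<^sub>R b)))) (at t)"
      by (rule bounded_linear.has_vector_derivative[OF bounded_linear_Re])
    then show ?thesis by (simp add: has_real_derivative_iff_has_vector_derivative mult_ac)
  qed
  have S: "slice_deriv2 (\<lambda>z. Re (poly p z)) b x (Re (b * b * poly (pderiv (pderiv p)) x))" for b
    using D[of 1 p b] D[of b "pderiv p" b 0]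
    by (intro slice_deriv2I[where g = "\<lambda>t. Re (b * poly (pderiv p) (x + t *\<^sub>R b))"]) auto
  show ?thesis
    unfolding has_laplacian_def
    by (intro exI conjI, rule S, rule S) simp
qed

lemma slice_deriv2_local_max:
  assumes "slice_deriv2 f b x D" and "\<forall>\<^sub>F t in nhds 0. f (x + t *\<^sub>R b) \<le> f x"
  shows "D \<le> 0"
proof (rule ccontr)
  assume "\<not> D \<le> 0"
  then have "D > 0" by simp
  from assms(1) obtain g
    where g: "\<forall>\<^sub>F t in nhds 0. ((\<lambda>t. f (x + t *\<^sub>R b)) has_real_derivative g t) (at t)"
      "(g has_real_derivative D) (at 0)"
    unfolding slice_deriv2_def by blast
  obtain e1 where e1: "e1 > 0" "\<And>t. \<bar>t\<bar> < e1 \<Longrightarrow> ((\<lambda>t. f (x + t *\<^sub>R b)) has_real_derivative g t) (at t) \<and> f (x + t *\<^sub>R b) \<le> f x"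
    using eventually_conj[OF g(1) assms(2)] by (auto simp: eventually_nhds_metric dist_real_def)
  have "g 0 = 0"
    by (rule DERIV_local_max[of "\<lambda>t. f (x + t *\<^sub>R b)" _ 0 e1]) (use e1 in auto)
  then obtain e2 where e2: "e2 > 0" "\<And>t. 0 < t \<Longrightarrow> t < e2 \<Longrightarrow> g t > 0"
    using DERIV_pos_inc_right[OF g(2) \<open>D > 0\<close>] by auto
  define s where "s = min e1 e2 / 2"
  have s: "0 < s" "s < e1" "s < e2" using e1 e2 by (auto simp: s_def min_def)
  obtain y where y: "0 < y" "y < s" "f (x + s *\<^sub>R b) - f (x + 0 *\<^sub>R b) = (s - 0) * g y"
    using MVT2[of 0 s "\<lambda>t. f (x + t *\<^sub>R b)" g] e1(2) s by force
  have "g y > 0" using e2 y s by simp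
  then have "f (x + s *\<^sub>R b) > f x" using y s by (simp add: algebra_simps)
  then show False using e1(2)[of s] s by simp
qed

lemma has_laplacian_local_max:
  assumes "has_laplacian f L x" and "\<forall>\<^sub>F y in nhds x. f y \<le> f x"
  shows "L \<le> 0"
proof -
  have "\<forall>\<^sub>F t in nhds 0. f (x + t *\<^sub>R b) \<le> f x" for b
  proof -
    have "((\<lambda>t::real. x + t *\<^sub>R b) \<longlongrightarrow> x + 0 *\<^sub>R b) (nhds 0)"
      by (intro tendsto_intros filterlim_ident)
    then show ?thesis using eventually_compose_filterlim[OF assms(2)] by simp
  qed
  then show ?thesis
    using assms(1) slice_deriv2_local_max unfolding has_laplacian_def by (metis add_nonpos_nonpos)
qed

lemma has_laplacian_norm_square: "has_laplacian (\<lambda>y. (norm y)\<^sup>2) 4 x"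
proof -
  have "slice_deriv2 (\<lambda>y. (norm y)\<^sup>2) b x 2" if "norm b = 1" for b
  proof (rule slice_deriv2I[where g = "\<lambda>t. 2 * (x \<bullet> b) + 2 * t"])
    have "b \<bullet> b = 1" using that by (simp add: dot_square_norm)
    then have "(norm (x + t *\<^sub>R b))\<^sup>2 = x \<bullet> x + 2 * (x \<bullet> b) * t + t\<^sup>2" for t
      unfolding power2_norm_eq_inner by (simp add: algebra_simps inner_commute power2_eq_square)
    then show "((\<lambda>t. (norm (x + t *\<^sub>R b))\<^sup>2) has_real_derivative 2 * (x \<bullet> b) + 2 * t) (at t)" for t
      by (auto intro!: derivative_eq_intros)
  qed (auto intro!: derivative_eq_intros)
  from this[of 1] this[of \<i>] show ?thesis
    unfolding has_laplacian_def by (intro exI[of _ 2]) simp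
qed

text \<open>Adding the small multiple \<open>e |x|\<^sup>2\<close> makes the Laplacian strictly positive, so that a positive
  maximum inside \<open>K\<close> is impossible. Boundary behaviour is encoded in the hypothesis that points with
  \<open>f x > 0\<close> are interior, which avoids speaking about the boundary of \<open>K\<close>.\<close>

lemma maximum_principle:
  fixes f :: "complex \<Rightarrow> real"
  assumes K: "compact K" "continuous_on K f"
    and f: "\<And>x. x \<in> K \<Longrightarrow> f x > 0 \<Longrightarrow> x \<in> interior K \<and> (\<exists>L\<ge>0. has_laplacian f L x)"
    and "z \<in> K"
  shows "f z \<le> 0"
proof (rule ccontr)
  assume "\<not> f z \<le> 0"
  then have fz: "f z > 0" by simp
  obtain M where M: "M > 0" "\<And>x. x \<in> K \<Longrightarrow> norm x \<le> M"
    using compact_imp_bounded[OF K(1)] by (auto simp: bounded_pos)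
  define e where "e = f z / (2 * M\<^sup>2)"
  have e: "e > 0" using fz M by (simp add: e_def)
  define F where "F = (\<lambda>x. f x + e * ((norm x)\<^sup>2 - M\<^sup>2))"
  have "continuous_on K F" unfolding F_def by (intro continuous_intros K)
  then obtain x where x: "x \<in> K" "\<And>y. y \<in> K \<Longrightarrow> F y \<le> F x"
    using continuous_attains_sup[OF K(1)] \<open>z \<in> K\<close> by blast
  have "F z \<ge> f z - e * M\<^sup>2" using e by (simp add: F_def algebra_simps)
  also have "f z - e * M\<^sup>2 = f z / 2" using M by (simp add: e_def)
  finally have "F z > 0" using fz by linarith
  then have "F x > 0" using x(2)[OF \<open>z \<in> K\<close>] by linarith
  moreover have "e * ((norm x)\<^sup>2 - M\<^sup>2) \<le> 0"
    using e M(2)[OF x(1)] by (simp add: mult_le_0_iff power_mono)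
  ultimately have "f x > 0" by (simp add: F_def)
  with f[OF x(1)] obtain L where L: "x \<in> interior K" "L \<ge> 0" "has_laplacian f L x" by blast
  have "has_laplacian F (L + e * (4 - 0)) x"
    unfolding F_def
    by (intro has_laplacian_add has_laplacian_cmult has_laplacian_diff has_laplacian_const
        has_laplacian_norm_square L)
  moreover have "\<forall>\<^sub>F y in nhds x. F y \<le> F x"
    using L(1) x(2) by (auto simp: eventually_nhds interior_def)
  ultimately have "L + e * (4 - 0) \<le> 0" by (rule has_laplacian_local_max)
  then show False using L(2) e by simp
qed

text \<open>The function \<open>g x = 3 \<rho> / (\<rho>\<^sup>2 - |x - a|\<^sup>2)\<close> satisfies \<open>\<Delta>g \<le> g\<^sup>3\<close> and is infinite on the
  boundary of the disc, so it lies above every \<open>f\<close> with \<open>\<Delta>f \<ge> f\<^sup>3\<close>, however large \<open>f\<close> is on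
  the boundary. Its value at the centre is \<open>3 / \<rho>\<close>.\<close>

lemma keller_osserman:
  fixes f :: "complex \<Rightarrow> real"
  assumes "\<rho> > 0" "continuous_on (cball a \<rho>) f"
    and f: "\<And>x. x \<in> ball a \<rho> \<Longrightarrow> f x > 0 \<Longrightarrow> \<exists>L \<ge> f x ^ 3. has_laplacian f L x"
  shows "f a \<le> 3 / \<rho>"
proof -
  define g where "g = (\<lambda>x. 3 * \<rho> / (\<rho>\<^sup>2 - (norm (x - a))\<^sup>2))"
  have lap_g: "\<exists>L \<le> g x ^ 3. has_laplacian g L x" if "x \<in> ball a \<rho>" for x
  proof -
    define N where "N = \<rho>\<^sup>2 - (norm (x - a))\<^sup>2"
    have xa: "norm (x - a) < \<rho>" using that by (simp add: dist_norm norm_minus_commute)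
    then have N: "N > 0" by (simp add: N_def power_strict_mono)
    have S: "slice_deriv2 g b x (3 * \<rho> * (2 / N\<^sup>2 + 8 * ((x - a) \<bullet> b)\<^sup>2 / N ^ 3))" if "norm b = 1" for b
    proof -
      define P where "P = (\<lambda>t. N - 2 * ((x - a) \<bullet> b) * t - t\<^sup>2)"
      have "b \<bullet> b = 1" using that by (simp add: dot_square_norm)
      then have "\<rho>\<^sup>2 - (norm (x + t *\<^sub>R b - a))\<^sup>2 = P t" for t
        unfolding P_def N_def power2_norm_eq_inner
        by (simp add: algebra_simps inner_commute power2_eq_square)
      then have gP: "g (x + t *\<^sub>R b) = 3 * \<rho> / P t" for t by (simp add: g_def)
      have dP: "(P has_real_derivative (- 2 * ((x - a) \<bullet> b) - 2 * t)) (at t)" for t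
        unfolding P_def by (auto intro!: derivative_eq_intros)
      have "isCont P 0" using dP DERIV_isCont by blast
      moreover have "P 0 > 0" using N by (simp add: P_def)
      ultimately have "\<forall>\<^sub>F t in nhds 0. P t > 0"
        by (metis isCont_def tendsto_at_iff_tendsto_nhds order_tendstoD(1))
      then have "\<forall>\<^sub>F t in nhds 0. ((\<lambda>t. g (x + t *\<^sub>R b)) has_real_derivative
          3 * \<rho> * (2 * ((x - a) \<bullet> b) + 2 * t) / (P t)\<^sup>2) (at t)"
      proof eventually_elim
        case (elim t)
        then show ?case unfolding gP
          by (auto intro!: derivative_eq_intros dP simp: power2_eq_square field_simps)
      qed
      moreover have "((\<lambda>t. 3 * \<rho> * (2 * ((x - a) \<bullet> b) + 2 * t) / (P t)\<^sup>2) has_real_derivative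
          3 * \<rho> * (2 / N\<^sup>2 + 8 * ((x - a) \<bullet> b)\<^sup>2 / N ^ 3)) (at 0)"
        using N by (auto intro!: derivative_eq_intros dP simp: P_def power2_eq_square power3_eq_cube divide_simps)
          (simp add: algebra_simps)
      ultimately show ?thesis unfolding slice_deriv2_def
        by (intro exI[of _ "\<lambda>t. 3 * \<rho> * (2 * ((x - a) \<bullet> b) + 2 * t) / (P t)\<^sup>2"]) simp
    qed
    have "(norm (x - a))\<^sup>2 = ((x - a) \<bullet> 1)\<^sup>2 + ((x - a) \<bullet> \<i>)\<^sup>2"
      by (simp add: cmod_power2 inner_complex_def)
    then have "has_laplacian g (3 * \<rho> * (4 / N\<^sup>2 + 8 * (norm (x - a))\<^sup>2 / N ^ 3)) x"
      by (intro has_laplacianI[OF S S]) (simp_all only: norm_one norm_ii, argo)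
    moreover have "3 * \<rho> * (4 / N\<^sup>2 + 8 * (norm (x - a))\<^sup>2 / N ^ 3) \<le> g x ^ 3"
    proof -
      have "(norm (x - a))\<^sup>2 \<le> \<rho>\<^sup>2" using xa by (simp add: power_mono)
      moreover have key: "4 * (r - s) + 8 * s \<le> 9 * r" if "s \<le> r" "0 \<le> r" for r s :: real
        using that by argo
      ultimately have "4 * N + 8 * (norm (x - a))\<^sup>2 \<le> 9 * \<rho>\<^sup>2" unfolding N_def by (intro key) auto
      then have "3 * \<rho> * (4 * N + 8 * (norm (x - a))\<^sup>2) \<le> 3 * \<rho> * (9 * \<rho>\<^sup>2)"
        using \<open>\<rho> > 0\<close> by (intro mult_left_mono) auto
      then have "3 * \<rho> * (4 * N + 8 * (norm (x - a))\<^sup>2) / N ^ 3 \<le> (3 * \<rho> * (9 * \<rho>\<^sup>2)) / N ^ 3"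
        using N by (intro divide_right_mono) auto
      moreover have "3 * \<rho> * (4 / N\<^sup>2 + 8 * (norm (x - a))\<^sup>2 / N ^ 3) = 3 * \<rho> * (4 * N + 8 * (norm (x - a))\<^sup>2) / N ^ 3"
        using N by (simp add: field_simps power2_eq_square power3_eq_cube)
      moreover have "g x ^ 3 = (3 * \<rho> * (9 * \<rho>\<^sup>2)) / N ^ 3"
        by (simp add: g_def N_def power_divide power2_eq_square power3_eq_cube)
      ultimately show ?thesis by simp
    qed
    ultimately show ?thesis by blast
  qed
  obtain B where B: "\<And>x. x \<in> cball a \<rho> \<Longrightarrow> f x \<le> B" "B > 0"
  proof -
    have "bounded (f ` cball a \<rho>)"
      by (intro compact_imp_bounded compact_continuous_image assms) auto
    then obtain B where "B > 0" "\<forall>x\<in>cball a \<rho>. norm (f x) \<le> B" by (auto simp: bounded_pos)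
    then show thesis by (intro that[of B]) (auto simp: abs_le_iff)
  qed
  \<comment> \<open>On the circle of radius \<open>\<sigma>\<close> the barrier equals \<open>3 \<rho> / m\<close>, which is at least the maximum of \<open>f\<close>.\<close>
  define m where "m = min (3 * \<rho> / B) (\<rho>\<^sup>2 / 2)"
  define \<sigma> where "\<sigma> = sqrt (\<rho>\<^sup>2 - m)"
  have m: "m > 0" "m \<le> 3 * \<rho> / B" "m \<le> \<rho>\<^sup>2 / 2" using assms(1) B by (auto simp: m_def)
  then have "m < \<rho>\<^sup>2" by linarith
  with m have \<sigma>: "\<sigma>\<^sup>2 = \<rho>\<^sup>2 - m" "\<sigma> > 0" by (auto simp: \<sigma>_def)
  then have "\<sigma> < \<rho>" using m assms(1) by (metis diff_less_eq less_add_same_cancel1 less_eq_real_def power2_less_imp_less)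
  have "f a - g a \<le> 0"
  proof (rule maximum_principle[of "cball a \<sigma>" "\<lambda>x. f x - g x"])
    have "\<rho>\<^sup>2 - (norm (x - a))\<^sup>2 \<noteq> 0" if "x \<in> cball a \<sigma>" for x
      using that \<open>\<sigma> < \<rho>\<close> assms(1) norm_ge_zero[of "a - x"]
      by (auto simp: dist_norm norm_minus_commute power2_eq_iff simp del: norm_ge_zero)
    moreover have "cball a \<sigma> \<subseteq> cball a \<rho>" using \<open>\<sigma> < \<rho>\<close> by (auto)
    ultimately show "continuous_on (cball a \<sigma>) (\<lambda>x. f x - g x)"
      unfolding g_def by (intro continuous_intros continuous_on_subset[OF assms(2)]) auto
  next
    fix x assume x: "x \<in> cball a \<sigma>" "f x - g x > 0"
    then have xb: "x \<in> ball a \<rho>" "x \<in> cball a \<rho>" using \<open>\<sigma> < \<rho>\<close> by (auto)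
    have gpos: "g x > 0" using xb(1) assms(1) by (simp add: g_def dist_norm norm_minus_commute power_strict_mono)
    have "norm (x - a) \<noteq> \<sigma>"
    proof
      assume "norm (x - a) = \<sigma>"
      then have "g x = 3 * \<rho> / m" by (simp add: g_def \<sigma>)
      also have "\<dots> \<ge> B" using m B(2) assms(1) by (simp add: field_simps)
      finally show False using B(1)[OF xb(2)] x(2) by simp
    qed
    then have int: "x \<in> interior (cball a \<sigma>)" using x(1) by (simp add: dist_norm norm_minus_commute)
    obtain L where L: "L \<ge> f x ^ 3" "has_laplacian f L x" using f[OF xb(1)] x(2) gpos by force
    obtain M where M: "M \<le> g x ^ 3" "has_laplacian g M x" using lap_g[OF xb(1)] by blast
    have "g x ^ 3 \<le> f x ^ 3" using x(2) gpos by (intro power_mono) auto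
    then have "L - M \<ge> 0" using L M by linarith
    then show "x \<in> interior (cball a \<sigma>) \<and> (\<exists>L\<ge>0. has_laplacian (\<lambda>x. f x - g x) L x)"
      using int has_laplacian_diff[OF L(2) M(2)] by blast
  qed (use \<sigma> in auto)
  moreover have "g a = 3 / \<rho>" using assms(1) by (simp add: g_def power2_eq_square)
  ultimately show ?thesis by simp
qed

section \<open>Trigonometric polynomials on the circle\<close>

lemma cis_eq_imp_periodic_eq:
  fixes F :: "real \<Rightarrow> 'a"
  assumes per: "\<And>\<beta>. F (\<beta> + 2 * pi) = F \<beta>" and "cis x = cis y"
  shows "F x = F y"
proof -
  have nat: "F (\<beta> + 2 * pi * real n) = F \<beta>" for \<beta> n
  proof (induction n)
    case (Suc n)
    then show ?case using per[of "\<beta> + 2 * pi * real n"] by (simp add: algebra_simps)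
  qed simp
  have int: "F (\<beta> + 2 * pi * real_of_int n) = F \<beta>" for \<beta> n
  proof (cases n rule: int_cases2)
    case (nonneg m)
    then show ?thesis using nat[of \<beta> m] by simp
  next
    case (nonpos m)
    then show ?thesis using nat[of "\<beta> - 2 * pi * real m" m] by simp
  qed
  have "sin x = sin y \<and> cos x = cos y" using assms(2) by (simp add: complex_eq_iff)
  then obtain n :: int where "x = y + 2 * pi * n" unfolding sin_cos_eq_iff by blast
  then show ?thesis using int[of y n] by simp
qed

text \<open>On the unit circle \<open>z * cnj z = 1\<close>, so mixed monomials \<open>z\<^sup>j * cnj z\<^sup>k\<close> reduce to powers of
  \<open>z\<close> or of \<open>cnj z\<close>. Hence real parts of polynomials are closed under products there.\<close>

lemma circle_poly_mult_cnj:
  fixes p q :: "complex poly"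
  shows "\<exists>r. \<forall>z. norm z = 1 \<longrightarrow> Re (poly p z * cnj (poly q z)) = Re (poly r z)"
proof (induction p arbitrary: q)
  case 0
  show ?case by (rule exI[of _ 0]) simp
next
  case (pCons a p)
  obtain b q' where q: "q = pCons b q'" by (cases q)
  from pCons.IH[of q'] obtain r where r: "\<And>z. norm z = 1 \<Longrightarrow> Re (poly p z * cnj (poly q' z)) = Re (poly r z)" by blast
  show ?case
  proof (intro exI[of _ "smult (cnj a) q + smult (cnj b) (pCons 0 p) + r"] allI impI)
    fix z :: complex assume z: "norm z = 1"
    have "poly (pCons a p) z * cnj (poly q z) =
        a * cnj (poly q z) + z * poly p z * cnj b + (z * cnj z) * (poly p z * cnj (poly q' z))"
      by (simp add: q algebra_simps)
    also have "z * cnj z = 1" using z by (simp add: complex_norm_square[symmetric])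
    finally have "Re (poly (pCons a p) z * cnj (poly q z)) =
        Re (a * cnj (poly q z)) + Re (z * poly p z * cnj b) + Re (poly p z * cnj (poly q' z))" by simp
    moreover have "Re (a * cnj (poly q z)) = Re (cnj a * poly q z)" by simp
    moreover have "Re (z * poly p z * cnj b) = Re (cnj b * (z * poly p z))" by (simp add: mult_ac)
    ultimately show "Re (poly (pCons a p) z * cnj (poly q z)) =
        Re (poly (smult (cnj a) q + smult (cnj b) (pCons 0 p) + r) z)"
      using r[OF z] by (simp add: algebra_simps)
  qed
qed

text \<open>A periodic function descends to the circle, where Stone-Weierstrass gives an approximation by
  polynomials in \<open>Re z\<close> and \<open>Im z\<close>; on the circle these are real parts of polynomials in \<open>z\<close>.
  This form is chosen because \<open>Re (poly p z)\<close> is then an explicit harmonic extension to the disc,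
  which replaces the Poisson integral throughout.\<close>

lemma trig_approx:
  fixes F :: "real \<Rightarrow> real"
  assumes cont: "continuous_on UNIV F" and per: "\<And>\<beta>. F (\<beta> + 2 * pi) = F \<beta>" and "e > 0"
  obtains p :: "complex poly" where "\<And>\<beta>. \<bar>F \<beta> - Re (poly p (cis \<beta>))\<bar> < e"
proof -
  have contF: "isCont F x" for x using cont by (simp add: continuous_on_eq_continuous_at)
  define G where "G = (\<lambda>z. F (Arg z))"
  have G2: "F (Arg (- z) + pi) = G z" if "norm z = 1" for z
    unfolding G_def
  proof (rule cis_eq_imp_periodic_eq[of F, OF per])
    have "z \<noteq> 0" using that by auto
    then have "cis (Arg (- z)) = - z" "cis (Arg z) = z" using that by (simp_all add: cis_Arg sgn_div_norm)
    moreover have "cis (Arg (- z) + pi) = - cis (Arg (- z))" by (simp add: complex_eq_iff)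
    ultimately show "cis (Arg (- z) + pi) = cis (Arg z)" by simp
  qed
  have "continuous (at z within sphere 0 1) G" if z: "z \<in> sphere 0 1" for z
  proof (cases "z \<in> \<real>\<^sub>\<le>\<^sub>0")
    case False
    then have "isCont (\<lambda>z. F (Arg z)) z"
      by (intro isCont_o2[OF continuous_at_Arg contF])
    then show ?thesis by (simp add: G_def continuous_at_imp_continuous_at_within)
  next
    case True
    have "z \<noteq> 0" using z by auto
    with True have "- z \<notin> \<real>\<^sub>\<le>\<^sub>0"
      by (auto simp: complex_nonpos_Reals_iff complex_eq_iff)
    then have "isCont Arg (- z)" by (rule continuous_at_Arg)
    moreover have "isCont (\<lambda>z. - z) z" by (intro continuous_intros)
    ultimately have "isCont (\<lambda>z. Arg (- z)) z" using isCont_o2[of z "\<lambda>z. - z" Arg] by blast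
    then have "isCont (\<lambda>z. Arg (- z) + pi) z" by (intro continuous_intros)
    then have "isCont (\<lambda>z. F (Arg (- z) + pi)) z" by (intro isCont_o2[OF _ contF])
    then have "continuous (at z within sphere 0 1) (\<lambda>z. F (Arg (- z) + pi))"
      by (rule continuous_at_imp_continuous_at_within)
    then show ?thesis
      by (rule continuous_transform_within[of _ _ _ 1]) (use z G2 in auto)
  qed
  then have "continuous_on (sphere 0 1) G" by (simp add: continuous_on_eq_continuous_within)
  then obtain g where g: "real_polynomial_function g" "\<And>z. z \<in> sphere 0 1 \<Longrightarrow> \<bar>G z - g z\<bar> < e"
    using Stone_Weierstrass_real_polynomial_function[of "sphere 0 1" G e] \<open>e > 0\<close> by auto
  have "\<exists>p. \<forall>z. norm z = 1 \<longrightarrow> g z = Re (poly p z)" using g(1)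
  proof induction
    case (linear f)
    interpret bounded_linear f by fact
    have "f z = Re (poly [:0, Complex (f 1) (- f \<i>):] z)" for z
    proof -
      have "z = Re z *\<^sub>R 1 + Im z *\<^sub>R \<i>" by (simp add: complex_eq_iff)
      then have "f z = f (Re z *\<^sub>R 1 + Im z *\<^sub>R \<i>)" by (rule arg_cong)
      also have "\<dots> = Re z * f 1 + Im z * f \<i>" unfolding add scaleR by simp
      finally have "f z = Re z * f 1 + Im z * f \<i>" .
      then show ?thesis by simp
    qed
    then show ?case by blast
  next
    case (const c)
    show ?case by (rule exI[of _ "[:of_real c:]"]) simp
  next
    case (add f h)
    then obtain p q where "\<forall>z. norm z = 1 \<longrightarrow> f z = Re (poly p z)" "\<forall>z. norm z = 1 \<longrightarrow> h z = Re (poly q z)"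
      by blast
    then show ?case by (intro exI[of _ "p + q"]) simp
  next
    case (mult f h)
    then obtain p q where pq: "\<forall>z. norm z = 1 \<longrightarrow> f z = Re (poly p z)" "\<forall>z. norm z = 1 \<longrightarrow> h z = Re (poly q z)"
      by blast
    obtain r where r: "\<forall>z. norm z = 1 \<longrightarrow> Re (poly p z * cnj (poly q z)) = Re (poly r z)"
      using circle_poly_mult_cnj by blast
    have "Re a * Re b = Re (a * b) / 2 + Re (a * cnj b) / 2" for a b by (simp add: field_simps)
    moreover have "Re (1 / 2 * a + 1 / 2 * b) = Re a / 2 + Re b / 2" for a b by simp
    ultimately have "f z * h z = Re (poly (smult (1 / 2) (p * q) + smult (1 / 2) r) z)" if "norm z = 1" for z
      using pq(1)[rule_format, OF that] pq(2)[rule_format, OF that] r[rule_format, OF that]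
      by (simp only: poly_add poly_smult poly_mult)
    then show ?case by blast
  qed
  then obtain p where p: "\<And>z. norm z = 1 \<Longrightarrow> g z = Re (poly p z)" by blast
  have "\<bar>F \<beta> - Re (poly p (cis \<beta>))\<bar> < e" for \<beta>
  proof -
    have "G (cis \<beta>) = F \<beta>" unfolding G_def
      by (rule cis_eq_imp_periodic_eq[of F, OF per]) (simp add: cis_Arg sgn_div_norm)
    then show ?thesis using g(2)[of "cis \<beta>"] p[of "cis \<beta>"] by simp
  qed
  then show thesis by (rule that)
qed

text \<open>The odd part of an approximation of an odd function is as good as the approximation itself. Odd
  trigonometric polynomials, that is sine sums, are those with purely imaginary coefficients.\<close>

lemma odd_trig_approx:
  fixes F :: "real \<Rightarrow> real"
  assumes cont: "continuous_on UNIV F" and per: "\<And>\<beta>. F (\<beta> + 2 * pi) = F \<beta>"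
    and odd: "\<And>\<beta>. F (- \<beta>) = - F \<beta>" and "e > 0"
  obtains p :: "complex poly" where "\<And>k. Re (coeff p k) = 0" "\<And>\<beta>. \<bar>F \<beta> - Re (poly p (cis \<beta>))\<bar> < e"
proof -
  obtain q where q: "\<And>\<beta>. \<bar>F \<beta> - Re (poly q (cis \<beta>))\<bar> < e"
    using trig_approx[OF cont per \<open>e > 0\<close>] by blast
  define p where "p = smult (1 / 2) (q - map_poly cnj q)"
  have "Re (coeff p k) = 0" for k
    by (simp add: p_def coeff_map_poly)
  moreover have "\<bar>F \<beta> - Re (poly p (cis \<beta>))\<bar> < e" for \<beta>
  proof -
    have "poly (map_poly cnj q) (cis \<beta>) = cnj (poly q (cis (- \<beta>)))"
    proof -
      have "cnj (cis (- \<beta>)) = cis \<beta>" by (simp add: complex_eq_iff)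
      then show ?thesis by (simp only: poly_cnj)
    qed
    then have "poly p (cis \<beta>) = 1 / 2 * (poly q (cis \<beta>) - cnj (poly q (cis (- \<beta>))))"
      unfolding p_def by (simp only: poly_smult poly_diff)
    moreover have "Re (1 / 2 * (a - cnj b)) = (Re a - Re b) / 2" for a b by simp
    ultimately have "Re (poly p (cis \<beta>)) = (Re (poly q (cis \<beta>)) - Re (poly q (cis (- \<beta>)))) / 2"
      by (simp only:)
    moreover have "\<bar>a - (x - y) / 2\<bar> < e" if "\<bar>a - x\<bar> < e" "\<bar>- a - y\<bar> < e" for a x y
      using that by argo
    ultimately show ?thesis using q[of \<beta>] q[of "- \<beta>"] unfolding odd by simp
  qed
  ultimately show thesis by (rule that)
qed

lemma Re_poly_polar:
  "Re (poly p (of_real r * cis \<beta>)) = (\<Sum>k\<le>degree p. r ^ k * Re (coeff p k * cis (real k * \<beta>)))"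
  unfolding poly_altdef Re_sum power_mult_distrib Complex.DeMoivre
proof (intro sum.cong refl)
  fix k
  have "coeff p k * (complex_of_real r ^ k * cis (real k * \<beta>)) = of_real (r ^ k) * (coeff p k * cis (real k * \<beta>))"
    by (simp only: of_real_power mult_ac)
  moreover have "Re (of_real a * w) = a * Re w" for a w by simp
  ultimately show "Re (coeff p k * (complex_of_real r ^ k * cis (real k * \<beta>))) = r ^ k * Re (coeff p k * cis (real k * \<beta>))"
    by (simp only:)
qed

lemma has_integral_cos_affine:
  fixes m :: int and \<mu> :: real
  assumes "m \<noteq> 0"
  shows "((\<lambda>\<beta>. cos (real_of_int m * \<beta> + \<mu>)) has_integral 0) {- pi..pi}"
proof -
  have "((\<lambda>\<beta>. cos (real_of_int m * \<beta> + \<mu>)) has_integral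
      (sin (real_of_int m * pi + \<mu>) / m - sin (real_of_int m * (- pi) + \<mu>) / m)) {- pi..pi}"
    using assms
    by (intro fundamental_theorem_of_calculus)
      (auto intro!: derivative_eq_intros simp flip: has_real_derivative_iff_has_vector_derivative)
  moreover have "sin (real_of_int m * pi) = 0" using sin_npi_int[of m] by (simp only: mult.commute)
  ultimately show ?thesis by (simp add: sin_add sin_diff)
qed

lemma has_integral_cos_int:
  fixes m :: int
  assumes "m \<noteq> 0"
  shows "((\<lambda>\<beta>. cos (real_of_int m * \<beta>)) has_integral 0) {0..pi}"
proof -
  have "((\<lambda>\<beta>. cos (real_of_int m * \<beta>)) has_integral
      (sin (real_of_int m * pi) / m - sin (real_of_int m * 0) / m)) {0..pi}"
    using assms
    by (intro fundamental_theorem_of_calculus)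
      (auto intro!: derivative_eq_intros simp flip: has_real_derivative_iff_has_vector_derivative)
  moreover have "sin (real_of_int m * pi) = 0" using sin_npi_int[of m] by (simp only: mult.commute)
  ultimately show ?thesis by simp
qed

lemma Re_mult_cis: "Re (c * cis x) = norm c * cos (x + Arg c)"
proof -
  have "c * cis x = of_real (norm c) * cis (Arg c + x)"
    by (metis cis_mult mult.assoc rcis_cmod_Arg rcis_def)
  then show ?thesis by (simp add: add.commute)
qed

text \<open>The phase \<open>Arg (coeff p j)\<close> rotates the test function so that the integral detects the modulus of
  the coefficient and no separate sine and cosine coefficients are needed.\<close>

lemma fourier_coeff:
  fixes p :: "complex poly"
  assumes "j \<ge> 1"
  shows "((\<lambda>\<beta>. Re (poly p (cis \<beta>)) * cos (real j * \<beta> + Arg (coeff p j))) has_integral pi * norm (coeff p j)) {- pi..pi}"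
proof -
  define \<gamma> where "\<gamma> k = Arg (coeff p k)" for k
  have one: "((\<lambda>\<beta>. Re (coeff p k * cis (real k * \<beta>)) * cos (real j * \<beta> + \<gamma> j)) has_integral
      (if k = j then pi * norm (coeff p j) else 0)) {- pi..pi}" for k
  proof -
    have prod: "Re (coeff p k * cis (real k * \<beta>)) * cos (real j * \<beta> + \<gamma> j) = norm (coeff p k) / 2 *
        (cos (real_of_int (int k + int j) * \<beta> + (\<gamma> k + \<gamma> j)) + cos (real_of_int (int k - int j) * \<beta> + (\<gamma> k - \<gamma> j)))" for \<beta>
    proof -
      have "cos (real k * \<beta> + \<gamma> k) * cos (real j * \<beta> + \<gamma> j) =
        (cos (real_of_int (int k + int j) * \<beta> + (\<gamma> k + \<gamma> j)) + cos (real_of_int (int k - int j) * \<beta> + (\<gamma> k - \<gamma> j))) / 2"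
        unfolding cos_times_cos by (simp add: algebra_simps)
      then show ?thesis unfolding Re_mult_cis \<gamma>_def by simp
    qed
    have 1: "((\<lambda>\<beta>. cos (real_of_int (int k + int j) * \<beta> + (\<gamma> k + \<gamma> j))) has_integral 0) {- pi..pi}"
      using assms by (intro has_integral_cos_affine) simp
    have 2: "((\<lambda>\<beta>. cos (real_of_int (int k - int j) * \<beta> + (\<gamma> k - \<gamma> j))) has_integral (if k = j then 2 * pi else 0)) {- pi..pi}"
    proof (cases "k = j")
      case True
      then show ?thesis using has_integral_const_real[of "1::real" "- pi" pi] by simp
    next
      case False
      then show ?thesis using has_integral_cos_affine[of "int k - int j"] by simp
    qed
    show ?thesis unfolding prod
      using has_integral_mult_right[OF has_integral_add[OF 1 2], of "norm (coeff p k) / 2"]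
      by (simp add: mult.commute split: if_splits)
  qed
  have "((\<lambda>\<beta>. \<Sum>k\<le>degree p. Re (coeff p k * cis (real k * \<beta>)) * cos (real j * \<beta> + \<gamma> j)) has_integral
      (\<Sum>k\<le>degree p. if k = j then pi * norm (coeff p j) else 0)) {- pi..pi}"
    by (intro has_integral_sum one) simp
  moreover have "(\<Sum>k\<le>degree p. if k = j then pi * norm (coeff p j) else 0) = pi * norm (coeff p j)"
    by (simp add: coeff_eq_0 not_le)
  moreover have "Re (poly p (cis \<beta>)) = (\<Sum>k\<le>degree p. Re (coeff p k * cis (real k * \<beta>)))" for \<beta>
    using Re_poly_polar[of p 1 \<beta>] by simp
  ultimately show ?thesis by (simp add: sum_distrib_right \<gamma>_def)
qed

lemma continuous_on_Re_poly_cis [continuous_intros]: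
  "continuous_on S (\<lambda>\<beta>. Re (poly p (of_real r * cis \<beta>)))"
  unfolding poly_altdef by (intro continuous_intros)

lemma continuous_on_Re_poly_cis1 [continuous_intros]:
  "continuous_on S (\<lambda>\<beta>. Re (poly p (cis \<beta>)))"
  using continuous_on_Re_poly_cis[of S p 1] by simp

lemma norm_fourier_coeff_le:
  fixes p :: "complex poly"
  shows "pi * \<bar>Re (coeff p 0)\<bar> \<le> integral {- pi..pi} (\<lambda>\<beta>. \<bar>Re (poly p (cis \<beta>))\<bar>)"
    and "j \<ge> 1 \<Longrightarrow> pi * norm (coeff p j) \<le> integral {- pi..pi} (\<lambda>\<beta>. \<bar>Re (poly p (cis \<beta>))\<bar>)"
proof -
  let ?I = "integral {- pi..pi} (\<lambda>\<beta>. \<bar>Re (poly p (cis \<beta>))\<bar>)"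
  have I: "((\<lambda>\<beta>. \<bar>Re (poly p (cis \<beta>))\<bar>) has_integral ?I) {- pi..pi}"
    by (intro integrable_integral integrable_continuous_interval continuous_intros)
  show "pi * norm (coeff p j) \<le> ?I" if "j \<ge> 1"
  proof (rule has_integral_le[OF fourier_coeff[OF that] I])
    fix \<beta>
    have "Re (poly p (cis \<beta>)) * cos (real j * \<beta> + Arg (coeff p j)) \<le> \<bar>Re (poly p (cis \<beta>))\<bar> * \<bar>cos (real j * \<beta> + Arg (coeff p j))\<bar>"
      by (metis abs_ge_self abs_mult)
    also have "\<dots> \<le> \<bar>Re (poly p (cis \<beta>))\<bar> * 1" by (intro mult_left_mono) auto
    finally show "Re (poly p (cis \<beta>)) * cos (real j * \<beta> + Arg (coeff p j)) \<le> \<bar>Re (poly p (cis \<beta>))\<bar>" by simp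
  qed
  have one: "((\<lambda>\<beta>. Re (coeff p k * cis (real k * \<beta>))) has_integral
      (if k = 0 then 2 * pi * Re (coeff p 0) else 0)) {- pi..pi}" for k
  proof (cases "k = 0")
    case True
    then show ?thesis using has_integral_const_real[of "Re (coeff p 0)" "- pi" pi] by simp
  next
    case False
    then show ?thesis
      using has_integral_mult_right[OF has_integral_cos_affine[of "int k" "Arg (coeff p k)"], of "norm (coeff p k)"]
      unfolding Re_mult_cis by simp
  qed
  have "((\<lambda>\<beta>. \<Sum>k\<le>degree p. Re (coeff p k * cis (real k * \<beta>))) has_integral
      (\<Sum>k\<le>degree p. if k = 0 then 2 * pi * Re (coeff p 0) else 0)) {- pi..pi}"
    by (intro has_integral_sum one) simp
  moreover have "Re (poly p (cis \<beta>)) = (\<Sum>k\<le>degree p. Re (coeff p k * cis (real k * \<beta>)))" for \<beta>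
    using Re_poly_polar[of p 1 \<beta>] by simp
  ultimately have "((\<lambda>\<beta>. Re (poly p (cis \<beta>))) has_integral 2 * pi * Re (coeff p 0)) {- pi..pi}"
    by simp
  then have "\<bar>2 * pi * Re (coeff p 0)\<bar> \<le> ?I"
    using integral_norm_bound_integral[of "\<lambda>\<beta>. Re (poly p (cis \<beta>))" "{- pi..pi}" "\<lambda>\<beta>. \<bar>Re (poly p (cis \<beta>))\<bar>"] I
    by (auto simp: has_integral_iff)
  moreover have "pi * \<bar>Re (coeff p 0)\<bar> \<le> \<bar>2 * pi * Re (coeff p 0)\<bar>" by (simp add: abs_mult)
  ultimately show "pi * \<bar>Re (coeff p 0)\<bar> \<le> ?I" by linarith
qed

text \<open>Substitute for the bound on the Poisson kernel: each coefficient is at most \<open>1 / pi\<close> times the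
  \<open>L\<^sup>1\<close> norm on the circle, and the geometric series \<open>\<Sum> q\<^sup>k\<close> gives the factor \<open>1 / (1 - q)\<close>.\<close>

lemma Re_poly_le_circle_integral:
  fixes p :: "complex poly"
  assumes "0 \<le> q" "q < 1"
  shows "Re (poly p (of_real q * cis \<beta>)) \<le> integral {- pi..pi} (\<lambda>\<beta>. \<bar>Re (poly p (cis \<beta>))\<bar>) / (pi * (1 - q))"
proof -
  define I where "I = integral {- pi..pi} (\<lambda>\<beta>. \<bar>Re (poly p (cis \<beta>))\<bar>)"
  have "I \<ge> 0" unfolding I_def by (intro integral_nonneg integrable_continuous_interval continuous_intros) auto
  have summand: "q ^ k * Re (coeff p k * cis (real k * \<beta>)) \<le> q ^ k * (I / pi)" for k
  proof (intro mult_left_mono)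
    show "Re (coeff p k * cis (real k * \<beta>)) \<le> I / pi"
    proof (cases "k = 0")
      case True
      have "pi * Re (coeff p 0) \<le> pi * \<bar>Re (coeff p 0)\<bar>" by simp
      also have "\<dots> \<le> I" using norm_fourier_coeff_le(1)[of p] by (simp add: I_def)
      finally show ?thesis using True by (simp add: field_simps)
    next
      case False
      have "Re (coeff p k * cis (real k * \<beta>)) \<le> norm (coeff p k * cis (real k * \<beta>))" by (rule complex_Re_le_cmod)
      also have "\<dots> \<le> I / pi" using norm_fourier_coeff_le(2)[of k p] False
        by (simp add: I_def field_simps norm_mult)
      finally show ?thesis .
    qed
  qed (use assms in simp)
  have "Re (poly p (of_real q * cis \<beta>)) \<le> (\<Sum>k\<le>degree p. q ^ k * (I / pi))"
    unfolding Re_poly_polar by (intro sum_mono summand)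
  also have "\<dots> = (\<Sum>k\<le>degree p. q ^ k) * (I / pi)" by (simp only: sum_distrib_right)
  also have "\<dots> \<le> 1 / (1 - q) * (I / pi)"
  proof (intro mult_right_mono)
    have "(\<Sum>k\<le>degree p. q ^ k) = (1 - q ^ Suc (degree p)) / (1 - q)"
      using assms by (subst sum_gp0) auto
    also have "\<dots> \<le> 1 / (1 - q)" using assms by (intro divide_right_mono) auto
    finally show "(\<Sum>k\<le>degree p. q ^ k) \<le> 1 / (1 - q)" .
  qed (use \<open>I \<ge> 0\<close> in auto)
  finally show ?thesis by (simp add: I_def field_simps)
qed


lemma abs_sin_mult_le: "\<bar>sin (real k * \<beta>)\<bar> \<le> real k * \<bar>sin \<beta>\<bar>"
proof (induction k)
  case (Suc k)
  have "\<bar>sin (real (Suc k) * \<beta>)\<bar> = \<bar>sin (real k * \<beta>) * cos \<beta> + cos (real k * \<beta>) * sin \<beta>\<bar>"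
    by (simp add: distrib_right add.commute[of \<beta>] sin_add)
  also have "\<dots> \<le> \<bar>sin (real k * \<beta>)\<bar> * \<bar>cos \<beta>\<bar> + \<bar>cos (real k * \<beta>)\<bar> * \<bar>sin \<beta>\<bar>"
    by (metis abs_mult abs_triangle_ineq)
  also have "\<dots> \<le> \<bar>sin (real k * \<beta>)\<bar> * 1 + 1 * \<bar>sin \<beta>\<bar>"
    by (intro add_mono mult_left_mono mult_right_mono) auto
  also have "\<dots> \<le> real (Suc k) * \<bar>sin \<beta>\<bar>" using Suc by (simp add: distrib_right)
  finally show ?case .
qed simp

lemma Re_imaginary_poly_polar:
  assumes "\<And>k. Re (coeff p k) = 0"
  shows "Re (poly p (of_real r * cis \<beta>)) = (\<Sum>k\<le>degree p. r ^ k * (- Im (coeff p k)) * sin (real k * \<beta>))"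
  unfolding Re_poly_polar using assms by (simp add: mult.assoc)

lemma imaginary_poly_sine_coeff:
  assumes "\<And>k. Re (coeff p k) = 0" "j \<ge> 1"
  shows "((\<lambda>\<beta>. Re (poly p (of_real r * cis \<beta>)) * sin (real j * \<beta>)) has_integral
    pi / 2 * (r ^ j * (- Im (coeff p j)))) {0..pi}"
proof -
  define a where "a k = r ^ k * (- Im (coeff p k))" for k
  have one: "((\<lambda>\<beta>. a k * sin (real k * \<beta>) * sin (real j * \<beta>)) has_integral
      (if k = j then pi / 2 * a j else 0)) {0..pi}" for k
  proof -
    have prod: "a k * sin (real k * \<beta>) * sin (real j * \<beta>) = a k / 2 *
        (cos (real_of_int (int k - int j) * \<beta>) - cos (real_of_int (int k + int j) * \<beta>))" for \<beta>
    proof -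
      have "sin (real k * \<beta>) * sin (real j * \<beta>) =
        (cos (real_of_int (int k - int j) * \<beta>) - cos (real_of_int (int k + int j) * \<beta>)) / 2"
        unfolding sin_times_sin by (simp add: algebra_simps)
      then show ?thesis by simp
    qed
    have 1: "((\<lambda>\<beta>. cos (real_of_int (int k + int j) * \<beta>)) has_integral 0) {0..pi}"
      using assms(2) by (intro has_integral_cos_int) simp
    have 2: "((\<lambda>\<beta>. cos (real_of_int (int k - int j) * \<beta>)) has_integral (if k = j then pi else 0)) {0..pi}"
    proof (cases "k = j")
      case True
      then show ?thesis using has_integral_const_real[of "1::real" 0 pi] by simp
    next
      case False
      then show ?thesis using has_integral_cos_int[of "int k - int j"] by simp
    qed
    show ?thesis unfolding prod
      using has_integral_mult_right[OF has_integral_diff[OF 2 1], of "a k / 2"]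
      by (simp add: mult.commute split: if_splits)
  qed
  have "((\<lambda>\<beta>. \<Sum>k\<le>degree p. a k * sin (real k * \<beta>) * sin (real j * \<beta>)) has_integral
      (\<Sum>k\<le>degree p. if k = j then pi / 2 * a j else 0)) {0..pi}"
    by (intro has_integral_sum one) simp
  moreover have "(\<Sum>k\<le>degree p. if k = j then pi / 2 * a j else 0) = pi / 2 * a j"
    by (simp add: a_def coeff_eq_0 not_le)
  ultimately show ?thesis
    by (simp add: Re_imaginary_poly_polar[OF assms(1)] sum_distrib_right a_def)
qed

lemma sum_square_half_power: "(\<Sum>k\<le>n. (real k)\<^sup>2 * (1 / 2) ^ k) \<le> 6"
proof -
  have "(\<Sum>k\<le>n. (real k)\<^sup>2 * (1 / 2) ^ k) = 6 - ((real n)\<^sup>2 + 4 * real n + 6) * (1 / 2) ^ n"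
    by (induction n) (simp_all add: field_simps power2_eq_square)
  then show ?thesis by simp
qed

text \<open>Near the centre the first sine mode dominates. The higher ones satisfy \<open>|sin (k \<beta>)| \<le> k sin \<beta>\<close>,
  so their coefficients are controlled by the integral with weight \<open>sin \<beta>\<close> and they vanish at the
  ends of the sector like the first mode does. The constant \<open>24 = 4 * 6\<close> comes from
  \<open>\<Sum> k\<^sup>2 / 2\<^sup>k \<le> 6\<close> and from \<open>q\<^sup>k \<le> 4 q\<^sup>2 / 2\<^sup>k\<close> for \<open>k \<ge> 2\<close>.\<close>

lemma imaginary_poly_lower_bound:
  assumes p: "\<And>k. Re (coeff p k) = 0" and q: "0 \<le> q" "q \<le> 1 / 2" and \<beta>: "0 \<le> \<beta>" "\<beta> \<le> pi"
  shows "Re (poly p (of_real q * cis \<beta>)) \<ge> 2 / pi * q * sin \<beta> *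
    (integral {0..pi} (\<lambda>\<beta>. Re (poly p (cis \<beta>)) * sin \<beta>) - 24 * q * integral {0..pi} (\<lambda>\<beta>. \<bar>Re (poly p (cis \<beta>))\<bar> * sin \<beta>))"
proof -
  define T where "T = (\<lambda>\<beta>. Re (poly p (cis \<beta>)))"
  define a where "a k = - Im (coeff p k)" for k
  define I where "I = integral {0..pi} (\<lambda>\<beta>. T \<beta> * sin \<beta>)"
  define J where "J = integral {0..pi} (\<lambda>\<beta>. \<bar>T \<beta>\<bar> * sin \<beta>)"
  have contT: "continuous_on S T" for S unfolding T_def by (rule continuous_on_Re_poly_cis1)
  have J: "((\<lambda>\<beta>. \<bar>T \<beta>\<bar> * sin \<beta>) has_integral J) {0..pi}"
    unfolding J_def by (intro integrable_integral integrable_continuous_interval continuous_intros contT)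
  have sin0: "sin \<beta> \<ge> 0" using \<beta> by (simp add: sin_ge_zero)
  have coef: "((\<lambda>\<beta>. T \<beta> * sin (real j * \<beta>)) has_integral pi / 2 * a j) {0..pi}" if "j \<ge> 1" for j
    using imaginary_poly_sine_coeff[OF p that, of 1] by (simp add: T_def a_def)
  have a1: "a 1 = 2 / pi * I"
    using coef[of 1] by (auto simp: I_def has_integral_iff field_simps)
  have bound: "\<bar>a j\<bar> \<le> 2 / pi * real j * J" if "j \<ge> 1" for j
  proof -
    have "norm (T x * sin (real j * x)) \<le> real j * (\<bar>T x\<bar> * sin x)" if "x \<in> {0..pi}" for x
    proof -
      have "\<bar>T x\<bar> * \<bar>sin (real j * x)\<bar> \<le> \<bar>T x\<bar> * (real j * \<bar>sin x\<bar>)"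
        by (intro mult_left_mono abs_sin_mult_le) auto
      then show ?thesis using that by (simp add: abs_mult sin_ge_zero mult_ac)
    qed
    then have "norm (integral {0..pi} (\<lambda>\<beta>. T \<beta> * sin (real j * \<beta>))) \<le> integral {0..pi} (\<lambda>x. real j * (\<bar>T x\<bar> * sin x))"
      by (intro integral_norm_bound_integral integrable_continuous_interval continuous_intros contT)
    also have "integral {0..pi} (\<lambda>\<beta>. T \<beta> * sin (real j * \<beta>)) = pi / 2 * a j"
      using coef[OF that] by (simp add: has_integral_iff)
    also have "integral {0..pi} (\<lambda>x. real j * (\<bar>T x\<bar> * sin x)) = real j * J"
      by (simp add: J_def)
    finally show ?thesis by (simp add: abs_mult field_simps)
  qed
  have J0: "J \<ge> 0" by (rule has_integral_nonneg[OF J]) (auto intro: mult_nonneg_nonneg sin_ge_zero)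
  have summand: "q ^ k * a k * sin (real k * \<beta>) \<ge> - (2 / pi * sin \<beta> * J * (4 * q\<^sup>2) * ((real k)\<^sup>2 * (1 / 2) ^ k))"
    if "k \<ge> 2" for k
  proof -
    have "q ^ k = q\<^sup>2 * q ^ (k - 2)" using that by (metis le_add_diff_inverse power_add)
    also have "\<dots> \<le> q\<^sup>2 * (1 / 2) ^ (k - 2)" using q by (intro mult_left_mono power_mono) auto
    also have "\<dots> = 4 * q\<^sup>2 * (1 / 2) ^ k" using that by (simp add: power_diff field_simps power2_eq_square)
    finally have qk: "q ^ k \<le> 4 * q\<^sup>2 * (1 / 2) ^ k" .
    have "\<bar>q ^ k * a k * sin (real k * \<beta>)\<bar> = q ^ k * (\<bar>a k\<bar> * \<bar>sin (real k * \<beta>)\<bar>)"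
      using q by (simp add: abs_mult)
    also have "\<dots> \<le> (4 * q\<^sup>2 * (1 / 2) ^ k) * ((2 / pi * real k * J) * (real k * \<bar>sin \<beta>\<bar>))"
      using that q J0 by (intro mult_mono qk bound abs_sin_mult_le) auto
    also have "\<dots> = 2 / pi * sin \<beta> * J * (4 * q\<^sup>2) * ((real k)\<^sup>2 * (1 / 2) ^ k)"
      using sin0 by (simp add: power2_eq_square)
    finally show ?thesis by linarith
  qed
  have "Re (poly p (of_real q * cis \<beta>)) = (\<Sum>k\<le>degree p. q ^ k * a k * sin (real k * \<beta>))"
    unfolding Re_imaginary_poly_polar[OF p] a_def by simp
  also have "\<dots> = (\<Sum>k\<le>degree p + 1. q ^ k * a k * sin (real k * \<beta>))"
    by (simp add: a_def coeff_eq_0)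
  also have "\<dots> = q * a 1 * sin \<beta> + (\<Sum>k\<in>{2..degree p + 1}. q ^ k * a k * sin (real k * \<beta>))"
  proof -
    have "{..degree p + 1} = insert 0 (insert 1 {2..degree p + 1})" by auto
    then show ?thesis by simp
  qed
  also have "\<dots> \<ge> q * a 1 * sin \<beta> + (\<Sum>k\<in>{2..degree p + 1}. - (2 / pi * sin \<beta> * J * (4 * q\<^sup>2) * ((real k)\<^sup>2 * (1 / 2) ^ k)))"
    by (intro add_left_mono sum_mono summand) auto
  also have "(\<Sum>k\<in>{2..degree p + 1}. - (2 / pi * sin \<beta> * J * (4 * q\<^sup>2) * ((real k)\<^sup>2 * (1 / 2) ^ k))) =
      - (2 / pi * sin \<beta> * J * (4 * q\<^sup>2) * (\<Sum>k\<in>{2..degree p + 1}. (real k)\<^sup>2 * (1 / 2) ^ k))"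
    by (simp only: sum_distrib_left sum_negf)
  also have "q * a 1 * sin \<beta> + - (2 / pi * sin \<beta> * J * (4 * q\<^sup>2) * (\<Sum>k\<in>{2..degree p + 1}. (real k)\<^sup>2 * (1 / 2) ^ k)) \<ge>
      q * a 1 * sin \<beta> + - (2 / pi * sin \<beta> * J * (4 * q\<^sup>2) * 6)"
  proof -
    have "(\<Sum>k\<in>{2..degree p + 1}. (real k)\<^sup>2 * (1 / 2) ^ k) \<le> (\<Sum>k\<le>degree p + 1. (real k)\<^sup>2 * (1 / 2) ^ k)"
      by (intro sum_mono2) auto
    also have "\<dots> \<le> 6" by (rule sum_square_half_power)
    finally show ?thesis using sin0 J0 by (intro add_left_mono le_imp_neg_le mult_left_mono) auto
  qed
  also have "q * a 1 * sin \<beta> + - (2 / pi * sin \<beta> * J * (4 * q\<^sup>2) * 6) = 2 / pi * q * sin \<beta> * (I - 24 * q * J)"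
    unfolding a1 by (simp add: field_simps power2_eq_square)
  finally show ?thesis unfolding I_def J_def T_def by simp
qed

lemma integral_symmetric_interval:
  fixes g :: "real \<Rightarrow> real"
  assumes "continuous_on UNIV g" "a \<ge> 0"
  shows "integral {- a..a} g = integral {0..a} (\<lambda>x. g x + g (- x))"
proof -
  have c: "continuous_on S g" for S using assms(1) by (rule continuous_on_subset) simp
  have "integral {- a..a} g = integral {- a..0} g + integral {0..a} g"
    using assms(2) by (intro Henstock_Kurzweil_Integration.integral_combine[symmetric] integrable_continuous_interval c) auto
  also have "integral {- a..0} g = integral {0..a} (\<lambda>x. g (- x))"
    using Henstock_Kurzweil_Integration.integral_reflect_real[of a 0 "\<lambda>x. g (- x)"] by simp
  also have "\<dots> + integral {0..a} g = integral {0..a} (\<lambda>x. g x + g (- x))"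
    by (subst Henstock_Kurzweil_Integration.integral_add)
      (auto intro!: integrable_continuous_interval c continuous_on_compose2[of UNIV g] continuous_intros assms)
  finally show ?thesis .
qed

section \<open>Coordinates adapted to the nodal lines\<close>

text \<open>The polar angle is rescaled and shifted so that \<open>\<i> z\<^sup>d = r\<^sup>d e\<^sup>i\<^sup>\<beta>\<close>. Then \<open>\<Phi> = r\<^sup>d sin \<beta>\<close>, the
  interval \<open>0 < \<beta> < pi\<close> describes one sector where \<open>\<Phi>\<close> is positive, and reflection in the nodal line
  \<open>\<beta> = 0\<close> is \<open>\<beta> \<mapsto> - \<beta>\<close>.\<close>

definition sector_pt :: "nat \<Rightarrow> real \<Rightarrow> real \<Rightarrow> complex" where
  "sector_pt d r \<beta> = rcis r ((\<beta> - pi / 2) / d)"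

lemma sector_pt_power:
  assumes "d \<ge> 1"
  shows "\<i> * sector_pt d r \<beta> ^ d = of_real (r ^ d) * cis \<beta>"
proof -
  have "sector_pt d r \<beta> ^ d = of_real (r ^ d) * cis (\<beta> - pi / 2)"
    unfolding sector_pt_def DeMoivre2 using assms by (simp add: rcis_def)
  moreover have "\<i> * cis (\<beta> - pi / 2) = cis \<beta>"
    by (simp add: complex_eq_iff cos_diff sin_diff)
  ultimately show ?thesis by (metis mult.left_commute)
qed

lemma \<Phi>_sector_pt: "d \<ge> 1 \<Longrightarrow> \<Phi> d (sector_pt d r \<beta>) = r ^ d * sin \<beta>"
proof -
  assume "d \<ge> 1"
  have "Re z = Im (\<i> * z)" for z by simp
  then have "\<Phi> d (sector_pt d r \<beta>) = Im (of_real (r ^ d) * cis \<beta>)"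
    unfolding \<Phi>_def using sector_pt_power[OF \<open>d \<ge> 1\<close>, of r \<beta>] by metis
  then show ?thesis by (simp del: of_real_power)
qed

lemma norm_sector_pt: "r \<ge> 0 \<Longrightarrow> norm (sector_pt d r \<beta>) = r"
  by (simp add: sector_pt_def)

lemma sector_pt_exhaust:
  assumes "d \<ge> 1"
  obtains \<beta> where "z = sector_pt d (norm z) \<beta>"
proof
  show "z = sector_pt d (norm z) (d * Arg z + pi / 2)"
    using assms by (simp add: sector_pt_def rcis_cmod_Arg)
qed

lemma continuous_on_sector_pt [continuous_intros]: "continuous_on S (\<lambda>\<beta>. sector_pt d r \<beta>)"
  unfolding sector_pt_def rcis_def divide_inverse by (intro continuous_intros)

text \<open>In the rescaled angle a trigonometric polynomial \<open>Re (poly p (cis \<beta>))\<close> on the circle of radius \<open>R\<close>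
  extends harmonically by inserting \<open>\<i> z\<^sup>d / R\<^sup>d\<close> for \<open>cis \<beta>\<close>.\<close>

lemma has_laplacian_harmonic_extension:
  "has_laplacian (\<lambda>z. Re (poly p (\<i> * z ^ d / of_real (R ^ d)))) 0 x"
proof -
  have "poly p (\<i> * z ^ d / of_real (R ^ d)) = poly (pcompose p (monom (\<i> / of_real (R ^ d)) d)) z" for z
    by (simp add: poly_pcompose poly_monom)
  then show ?thesis using has_laplacian_Re_poly[of "pcompose p (monom (\<i> / of_real (R ^ d)) d)" x] by simp
qed

lemma harmonic_extension_sector_pt:
  assumes "d \<ge> 1"
  shows "poly p (\<i> * sector_pt d r \<beta> ^ d / of_real (R ^ d)) = poly p (of_real ((r / R) ^ d) * cis \<beta>)"
  unfolding sector_pt_power[OF assms] by (simp add: power_divide)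

lemma continuous_on_harmonic_extension:
  "continuous_on S (\<lambda>z. Re (poly p (\<i> * z ^ d / of_real (R ^ d))))"
  unfolding divide_inverse poly_altdef by (intro continuous_intros)

text \<open>A subharmonic function lies below the harmonic extension of any trigonometric polynomial that
  dominates it on the circle. Letting this polynomial approach \<open>g\<close> bounds the value inside by the
  integral of \<open>g\<close>. Only an upper bound \<open>g\<close> for the boundary values is required, which later allows
  a uniformly small error to be subtracted from \<open>f\<close> instead of being integrated.\<close>

lemma subharmonic_le_integral:
  fixes f :: "complex \<Rightarrow> real" and g :: "real \<Rightarrow> real"
  assumes d: "d \<ge> 1" and r: "0 \<le> r" "r < R"
    and f: "continuous_on (cball 0 R) f" "\<And>z. z \<in> ball 0 R \<Longrightarrow> \<exists>L\<ge>0. has_laplacian f L z"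
    and g: "continuous_on UNIV g" "\<And>\<beta>. g (\<beta> + 2 * pi) = g \<beta>" "\<And>\<beta>. g \<beta> \<ge> 0"
    and fg: "\<And>\<beta>. f (sector_pt d R \<beta>) \<le> g \<beta>"
  shows "f (sector_pt d r \<beta>) \<le> integral {- pi..pi} g / (pi * (1 - (r / R) ^ d))"
proof (rule field_le_epsilon)
  fix e :: real assume "e > 0"
  define q where "q = (r / R) ^ d"
  have "R > 0" using r by simp
  have q: "0 \<le> q" "q < 1" using r d by (auto simp: q_def power_less_one_iff)
  define \<eta> where "\<eta> = e / (1 + 2 / (1 - q))"
  have "\<eta> > 0" using q \<open>e > 0\<close> by (auto simp: \<eta>_def intro!: divide_pos_pos add_pos_pos)
  then obtain p where p: "\<And>\<beta>. \<bar>g \<beta> - Re (poly p (cis \<beta>))\<bar> < \<eta>"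
    using trig_approx[OF g(1,2)] by blast
  define h where "h = (\<lambda>z. Re (poly p (\<i> * z ^ d / of_real (R ^ d))))"
  have "f z - h z - \<eta> \<le> 0" if "z \<in> cball 0 R" for z
  proof (rule maximum_principle[of "cball 0 R" "\<lambda>z. f z - h z - \<eta>"])
    show "continuous_on (cball 0 R) (\<lambda>z. f z - h z - \<eta>)"
      unfolding h_def by (intro continuous_on_diff f(1) continuous_on_harmonic_extension continuous_on_const)
  next
    fix x assume x: "x \<in> cball 0 R" "f x - h x - \<eta> > 0"
    have "norm x \<noteq> R"
    proof
      assume "norm x = R"
      then obtain \<beta> where \<beta>: "x = sector_pt d R \<beta>" using sector_pt_exhaust[OF d, of x] by metis
      then have "h x = Re (poly p (cis \<beta>))"
        using \<open>R > 0\<close> unfolding \<beta> h_def harmonic_extension_sector_pt[OF d] by simp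
      then show False using x(2) fg[of \<beta>] p[of \<beta>] \<beta> by (simp add: abs_less_iff)
    qed
    then have xb: "x \<in> ball 0 R" using x(1) by simp
    then obtain L where L: "L \<ge> 0" "has_laplacian f L x" using f(2) by blast
    have "has_laplacian (\<lambda>z. f z - h z - \<eta>) (L - 0 - 0) x"
      unfolding h_def by (rule has_laplacian_diff[OF has_laplacian_diff[OF L(2) has_laplacian_harmonic_extension] has_laplacian_const])
    then show "x \<in> interior (cball 0 R) \<and> (\<exists>L\<ge>0. has_laplacian (\<lambda>z. f z - h z - \<eta>) L x)"
      using xb L(1) by auto
  qed (use that in auto)
  from this[of "sector_pt d r \<beta>"] have "f (sector_pt d r \<beta>) \<le> h (sector_pt d r \<beta>) + \<eta>"
    using r by (simp add: norm_sector_pt)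
  also have "h (sector_pt d r \<beta>) \<le> integral {- pi..pi} (\<lambda>\<beta>. \<bar>Re (poly p (cis \<beta>))\<bar>) / (pi * (1 - q))"
    unfolding h_def harmonic_extension_sector_pt[OF d] q_def[symmetric]
    by (rule Re_poly_le_circle_integral[OF q])
  also have "integral {- pi..pi} (\<lambda>\<beta>. \<bar>Re (poly p (cis \<beta>))\<bar>) \<le> integral {- pi..pi} (\<lambda>\<beta>. g \<beta> + \<eta>)"
  proof (rule integral_le)
    show "\<bar>Re (poly p (cis \<beta>))\<bar> \<le> g \<beta> + \<eta>" for \<beta>
      using p[of \<beta>] g(3)[of \<beta>] by (auto simp: abs_if split: if_splits)
  qed (auto intro!: integrable_continuous_interval continuous_intros continuous_on_subset[OF g(1)])
  also have "integral {- pi..pi} (\<lambda>\<beta>. g \<beta> + \<eta>) = integral {- pi..pi} g + 2 * pi * \<eta>"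
    by (subst integral_add) (auto intro!: integrable_continuous_interval continuous_on_subset[OF g(1)])
  also have "(integral {- pi..pi} g + 2 * pi * \<eta>) / (pi * (1 - q)) + \<eta> = integral {- pi..pi} g / (pi * (1 - q)) + \<eta> * (1 + 2 / (1 - q))"
    by (simp add: add_divide_distrib distrib_left mult_ac)
  also have "\<eta> * (1 + 2 / (1 - q)) = e"
    using q by (simp add: \<eta>_def add_pos_pos add_nonneg_eq_0_iff)
  finally show "f (sector_pt d r \<beta>) \<le> integral {- pi..pi} g / (pi * (1 - (r / R) ^ d)) + e"
    using q by (simp add: q_def divide_right_mono)
qed

lemma continuous_on_C2: "C2 f \<Longrightarrow> continuous_on S f"
  by (auto simp: C2_def intro!: continuous_at_imp_continuous_on differentiable_imp_continuous_within)

lemma has_integral_sin_0_pi: "(sin has_integral 2) {0..pi}"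
proof -
  have "(sin has_integral (- cos pi - (- cos 0))) {0..pi}"
    by (intro fundamental_theorem_of_calculus)
      (auto intro!: derivative_eq_intros simp flip: has_real_derivative_iff_has_vector_derivative)
  then show ?thesis by simp
qed

section \<open>Decay of the smaller component and the first sine mode\<close>

locale symmetric_solution =
  fixes d :: nat and u v :: "complex \<Rightarrow> real"
  assumes d: "d \<ge> 1" and sol: "positive_solution u v"
    and pos: "\<And>z. \<Phi> d z > 0 \<Longrightarrow> u z - v z > 0"
    and refl: "\<And>L z. L \<in> nodal_lines d \<Longrightarrow> u (reflection L z) = v z"
begin

abbreviation "pt \<equiv> sector_pt d"

definition w :: "complex \<Rightarrow> real" where "w z = u z - v z"

text \<open>The coefficient of \<open>sin \<beta>\<close> in the sine series of the difference, up to the factor \<open>2 / pi\<close>. For a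
  function harmonic in a disc it is exactly proportional to \<open>R\<^sup>d\<close>.\<close>

definition first_mode :: "real \<Rightarrow> real" where
  "first_mode R = integral {0..pi} (\<lambda>\<beta>. w (pt R \<beta>) * sin \<beta>)"

lemma continuous_u: "continuous_on S u" and continuous_v: "continuous_on S v"
  using sol by (auto simp: positive_solution_def intro: continuous_on_C2)

lemma continuous_w: "continuous_on S w"
  unfolding w_def by (intro continuous_intros continuous_u continuous_v)

lemma continuous_u_pt: "continuous_on S (\<lambda>\<beta>. u (pt r \<beta>))"
  and continuous_v_pt: "continuous_on S (\<lambda>\<beta>. v (pt r \<beta>))"
  and continuous_w_pt: "continuous_on S (\<lambda>\<beta>. w (pt r \<beta>))"
  by (intro continuous_on_compose2[OF continuous_u[of UNIV]] continuous_on_compose2[OF continuous_v[of UNIV]]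
      continuous_on_compose2[OF continuous_w[of UNIV]] continuous_intros; simp)+

lemma u_pos: "u z > 0" and v_pos: "v z > 0"
  using sol by (auto simp: positive_solution_def)

lemma lap_u: "has_laplacian u (u z * (v z)\<^sup>2) z" and lap_v: "has_laplacian v (v z * (u z)\<^sup>2) z"
  using has_laplacian_C2[of u z] has_laplacian_C2[of v z] sol by (auto simp: positive_solution_def)

text \<open>The nodal lines are the directions \<open>b\<close> with \<open>sin b = 0\<close>. Using \<open>b = 0\<close> and \<open>b = pi\<close> together
  yields periodicity in \<open>\<beta>\<close> with period \<open>2 * pi\<close>, that is, invariance under rotation by \<open>2 * pi / d\<close>.\<close>

lemma u_pt_reflect:
  assumes "sin b = 0"
  shows "u (pt r (2 * b - \<beta>)) = v (pt r \<beta>)"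
proof -
  define a where "a = (b - pi / 2) / d"
  have "\<Phi> d (cis a) = 0"
    using \<Phi>_sector_pt[OF d, of 1 b] assms by (simp add: sector_pt_def a_def rcis_def)
  then have L: "span {cis a} \<in> nodal_lines d" using d by (intro nodal_line_through) auto
  have "reflection (span {cis a}) (pt r \<beta>) = pt r (2 * b - \<beta>)"
  proof -
    define \<theta> where "\<theta> = (\<beta> - pi / 2) / d"
    have "cis a \<bullet> cis a = 1" by (simp add: dot_square_norm)
    moreover have "rcis r \<theta> \<bullet> cis a = r * cos (\<theta> - a)"
      by (simp add: inner_complex_def cos_diff algebra_simps)
    ultimately have "reflection (span {cis a}) (rcis r \<theta>) = (2 * r * cos (\<theta> - a)) *\<^sub>R cis a - rcis r \<theta>"
      by (subst reflection_span) auto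
    also have "\<dots> = rcis r (2 * a - \<theta>)"
    proof -
      have "2 * cos (\<theta> - a) * cos a - cos \<theta> = cos (2 * a - \<theta>)"
        using cos_add[of "a - \<theta>" a] cos_add[of "a - \<theta>" "- a"] by (simp add: cos_diff sin_diff algebra_simps)
      moreover have "2 * cos (\<theta> - a) * sin a - sin \<theta> = sin (2 * a - \<theta>)"
        using sin_add[of "a - \<theta>" a] sin_add[of "a - \<theta>" "- a"] by (simp add: cos_diff sin_diff algebra_simps)
      ultimately show ?thesis
        by (simp add: complex_eq_iff) (metis mult.assoc mult.left_commute right_diff_distrib')
    qed
    also have "2 * a - \<theta> = (2 * b - \<beta> - pi / 2) / d" by (simp add: a_def \<theta>_def diff_divide_distrib add_divide_distrib)
    finally show ?thesis by (simp add: sector_pt_def \<theta>_def)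
  qed
  then show ?thesis using refl[OF L, of "pt r \<beta>"] by simp
qed

lemma v_pt: "v (pt r \<beta>) = u (pt r (- \<beta>))"
  using u_pt_reflect[of 0 r \<beta>] by simp

lemma v_pt_minus: "v (pt r (- \<beta>)) = u (pt r \<beta>)"
  using v_pt[of r "- \<beta>"] by simp

lemma u_pt_periodic: "u (pt r (\<beta> + 2 * pi)) = u (pt r \<beta>)"
  using u_pt_reflect[of pi r "- \<beta>"] v_pt_minus[of r \<beta>] by (simp add: add.commute)

lemma v_pt_periodic: "v (pt r (\<beta> + 2 * pi)) = v (pt r \<beta>)"
  using u_pt_periodic[of r "- \<beta> - 2 * pi"] by (simp add: v_pt)

lemma w_pt_odd: "w (pt r (- \<beta>)) = - w (pt r \<beta>)"
  by (simp add: w_def v_pt)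

lemma w_pt_periodic: "w (pt r (\<beta> + 2 * pi)) = w (pt r \<beta>)"
  by (simp only: w_def u_pt_periodic v_pt_periodic)

lemma w_zero:
  assumes "\<Phi> d z = 0" shows "w z = 0"
proof -
  obtain \<beta> where \<beta>: "z = pt (norm z) \<beta>" using sector_pt_exhaust[OF d] .
  have "norm z ^ d * sin \<beta> = 0" using assms \<Phi>_sector_pt[OF d] \<beta> by metis
  then consider "z = 0" | "sin \<beta> = 0" using d by (auto split: if_splits)
  then show ?thesis
  proof cases
    case 1
    then have "pt 0 \<beta> = z" for \<beta> by (simp add: sector_pt_def)
    then show ?thesis using v_pt[of 0 0] by (simp add: w_def)
  next
    case 2
    then have "cis (- \<beta>) = cis \<beta>" by (simp add: complex_eq_iff)
    then have "u (pt (norm z) (- \<beta>)) = u (pt (norm z) \<beta>)"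
      by (rule cis_eq_imp_periodic_eq[of "\<lambda>\<beta>. u (pt (norm z) \<beta>)", OF u_pt_periodic])
    then show ?thesis using v_pt \<beta> by (metis w_def diff_self)
  qed
qed

lemma w_pt_nonneg:
  assumes "r \<ge> 0" "0 \<le> \<beta>" "\<beta> \<le> pi" shows "w (pt r \<beta>) \<ge> 0"
proof -
  have "\<Phi> d (pt r \<beta>) \<ge> 0" using assms by (simp add: \<Phi>_sector_pt[OF d] sin_ge_zero)
  then show ?thesis using pos[of "pt r \<beta>"] w_zero[of "pt r \<beta>"] by (cases "\<Phi> d (pt r \<beta>) = 0") (auto simp: w_def)
qed

text \<open>Where \<open>\<Phi> > 0\<close>, \<open>v < u\<close> and therefore \<open>\<Delta>v = v u\<^sup>2 \<ge> v\<^sup>3\<close>. A disc of radius proportional to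
  \<open>r sin \<beta>\<close> around the point stays inside the sector, because \<open>z\<^sup>d\<close> varies there at rate at most
  \<open>d (2 r)\<^sup>d\<^sup>-\<^sup>1\<close>; the Keller-Osserman bound on that disc is the claim.\<close>

lemma v_decay:
  assumes "r > 0" "0 < \<beta>" "\<beta> < pi"
  shows "v (pt r \<beta>) \<le> 3 * d * 2 ^ d / 2 / (r * sin \<beta>)"
proof -
  define z where "z = pt r \<beta>"
  have nz: "norm z = r" using assms by (simp add: z_def norm_sector_pt)
  have s: "sin \<beta> > 0" using assms by (simp add: sin_gt_zero)
  have \<Phi>z: "\<Phi> d z = r ^ d * sin \<beta>" by (simp add: z_def \<Phi>_sector_pt[OF d])
  \<comment> \<open>On this disc \<open>|y\<^sup>d - z\<^sup>d|\<close> stays below \<open>\<Phi> d z\<close>, so \<open>\<Phi>\<close> cannot reach zero.\<close>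
  define \<rho> where "\<rho> = 2 * r * sin \<beta> / (d * 2 ^ d)"
  have \<rho>: "\<rho> > 0" using assms s d by (simp add: \<rho>_def)
  have "2 * sin \<beta> \<le> 2 * 1" by (intro mult_left_mono) auto
  also have "(2::real) \<le> real d * 2 ^ d"
  proof -
    have "(1::real) * 2 ^ 1 \<le> real d * 2 ^ d" using d by (intro mult_mono power_increasing) auto
    then show ?thesis by simp
  qed
  finally have "r * (2 * sin \<beta>) \<le> r * (real d * 2 ^ d)" using assms by (intro mult_left_mono) auto
  then have "\<rho> \<le> r" using d by (simp add: \<rho>_def field_simps)
  have \<Phi>pos: "\<Phi> d y > 0" if y: "y \<in> ball z \<rho>" for y
  proof -
    have "norm y \<le> 2 * r"
    proof -
      have "norm y \<le> norm z + norm (y - z)" by norm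
      then show ?thesis using y \<open>\<rho> \<le> r\<close> nz by (simp add: dist_norm norm_minus_commute)
    qed
    then have "norm (y / of_real (2 * r)) \<le> 1" "norm (z / of_real (2 * r)) \<le> 1"
      using nz assms by (auto simp: norm_divide divide_simps)
    then have "norm ((y / of_real (2 * r)) ^ d - (z / of_real (2 * r)) ^ d) \<le> d * norm (y / of_real (2 * r) - z / of_real (2 * r))"
      by (intro norm_power_diff)
    also have "y / of_real (2 * r) - z / of_real (2 * r) = (y - z) / of_real (2 * r)" by (simp add: diff_divide_distrib)
    also have "(y / of_real (2 * r)) ^ d - (z / of_real (2 * r)) ^ d = (y ^ d - z ^ d) / of_real ((2 * r) ^ d)"
      by (simp add: power_divide diff_divide_distrib)
    finally have "norm (y ^ d - z ^ d) / (2 * r) ^ d \<le> d * (norm (y - z) / (2 * r))"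
      using assms(1) by (simp add: norm_divide del: of_real_power of_real_mult)
    also have "\<dots> < d * (\<rho> / (2 * r))"
      using y d assms(1) by (intro mult_strict_left_mono divide_strict_right_mono) (auto simp: dist_norm norm_minus_commute)
    also have "d * (\<rho> / (2 * r)) = sin \<beta> / 2 ^ d"
      using assms(1) d by (simp add: \<rho>_def)
    finally have "norm (y ^ d - z ^ d) < sin \<beta> / 2 ^ d * (2 * r) ^ d"
      using assms(1) by (simp add: divide_less_eq)
    also have "\<dots> = \<Phi> d z" by (simp add: \<Phi>z power_mult_distrib)
    finally have "\<bar>Re (y ^ d - z ^ d)\<bar> < \<Phi> d z" using abs_Re_le_cmod le_less_trans by blast
    then show ?thesis unfolding \<Phi>_def by simp
  qed
  have "v z \<le> 3 / \<rho>"
  proof (rule keller_osserman[OF \<rho> continuous_v])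
    fix x assume "x \<in> ball z \<rho>"
    then have "v x < u x" using pos[OF \<Phi>pos] by force
    then have "(v x)\<^sup>2 \<le> (u x)\<^sup>2" using v_pos[of x] by (intro power_mono) auto
    then have "v x * (v x)\<^sup>2 \<le> v x * (u x)\<^sup>2" using v_pos[of x] by (intro mult_left_mono) auto
    then have "v x ^ 3 \<le> v x * (u x)\<^sup>2" by (simp add: power2_eq_square power3_eq_cube mult.assoc)
    then show "\<exists>L\<ge>v x ^ 3. has_laplacian v L x" using lap_v by blast
  qed
  also have "3 / \<rho> = 3 * d * 2 ^ d / 2 / (r * sin \<beta>)" by (simp add: \<rho>_def)
  finally show ?thesis by (simp add: z_def)
qed

text \<open>Where \<open>\<Phi> \<ge> 0\<close>, \<open>w\<close> is superharmonic and vanishes on the nodal lines, so it dominates the harmonic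
  extension of an approximation of its values on the circle of radius \<open>R\<close>. The approximation is odd
  in \<open>\<beta>\<close> so that its extension vanishes on the nodal lines as well.\<close>

lemma harmonic_minorant:
  assumes "R > 0" "\<epsilon> > 0"
  obtains p where "\<And>k. Re (coeff p k) = 0" "\<And>\<beta>. \<bar>w (pt R \<beta>) - Re (poly p (cis \<beta>))\<bar> < \<epsilon>"
    "\<And>r \<beta>. 0 \<le> r \<Longrightarrow> r \<le> R \<Longrightarrow> 0 \<le> \<beta> \<Longrightarrow> \<beta> \<le> pi \<Longrightarrow> w (pt r \<beta>) \<ge> Re (poly p (of_real ((r / R) ^ d) * cis \<beta>)) - \<epsilon>"
proof -
  obtain p where p: "\<And>k. Re (coeff p k) = 0" "\<And>\<beta>. \<bar>w (pt R \<beta>) - Re (poly p (cis \<beta>))\<bar> < \<epsilon>"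
    using odd_trig_approx[OF continuous_w_pt w_pt_periodic w_pt_odd \<open>\<epsilon> > 0\<close>, of R] by blast
  define h where "h = (\<lambda>z. Re (poly p (\<i> * z ^ d / of_real (R ^ d))))"
  define K where "K = cball 0 R \<inter> {z. \<Phi> d z \<ge> 0}"
  have clo: "closed {z. \<Phi> d z \<ge> 0}" and ope: "open {z. \<Phi> d z > 0}"
    unfolding \<Phi>_def by (intro closed_Collect_le open_Collect_less continuous_intros)+
  have "h z - w z - \<epsilon> \<le> 0" if "z \<in> K" for z
  proof (rule maximum_principle[of K "\<lambda>z. h z - w z - \<epsilon>"])
    show "compact K" unfolding K_def using clo by (intro compact_Int_closed) auto
    show "continuous_on K (\<lambda>z. h z - w z - \<epsilon>)"
      unfolding h_def by (intro continuous_on_diff continuous_w continuous_on_harmonic_extension continuous_on_const)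
  next
    fix x assume x: "x \<in> K" "h x - w x - \<epsilon> > 0"
    have "norm x \<noteq> R"
    proof
      assume "norm x = R"
      then obtain \<beta> where \<beta>: "x = pt R \<beta>" using sector_pt_exhaust[OF d, of x] by metis
      then have "h x = Re (poly p (cis \<beta>))"
        using \<open>R > 0\<close> unfolding \<beta> h_def harmonic_extension_sector_pt[OF d] by simp
      then show False using x(2) p(2)[of \<beta>] \<beta> by (simp add: abs_less_iff)
    qed
    moreover have "\<Phi> d x \<noteq> 0"
    proof
      assume 0: "\<Phi> d x = 0"
      then have "\<i> * x ^ d / of_real (R ^ d) = of_real (- Im (x ^ d) / R ^ d) * cis 0"
        by (simp add: \<Phi>_def complex_eq_iff del: of_real_power)
      then have "h x = 0" unfolding h_def using Re_imaginary_poly_polar[of p "- Im (x ^ d) / R ^ d" 0] p(1) by simp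
      then show False using x(2) w_zero[OF 0] assms(2) by simp
    qed
    ultimately have xi: "x \<in> ball 0 R \<inter> {z. \<Phi> d z > 0}" using x(1) by (auto simp: K_def)
    moreover have "open (ball 0 R \<inter> {z. \<Phi> d z > 0})" using ope by auto
    moreover have "ball 0 R \<inter> {z. \<Phi> d z > 0} \<subseteq> K" unfolding K_def by auto
    ultimately have "x \<in> interior K" unfolding interior_def by blast
    moreover have "has_laplacian (\<lambda>z. h z - w z - \<epsilon>) (0 - (u x * (v x)\<^sup>2 - v x * (u x)\<^sup>2) - 0) x"
      unfolding h_def w_def
      by (rule has_laplacian_diff[OF has_laplacian_diff[OF has_laplacian_harmonic_extension has_laplacian_diff[OF lap_u lap_v]] has_laplacian_const])
    moreover have "0 - (u x * (v x)\<^sup>2 - v x * (u x)\<^sup>2) - 0 = u x * v x * (u x - v x)"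
      by (simp add: power2_eq_square algebra_simps)
    moreover have "u x * v x * (u x - v x) \<ge> 0"
      using u_pos[of x] v_pos[of x] pos[of x] xi by auto
    ultimately show "x \<in> interior K \<and> (\<exists>L\<ge>0. has_laplacian (\<lambda>z. h z - w z - \<epsilon>) L x)" by metis
  qed (use that in auto)
  then have "w (pt r \<beta>) \<ge> Re (poly p (of_real ((r / R) ^ d) * cis \<beta>)) - \<epsilon>"
    if "0 \<le> r" "r \<le> R" "0 \<le> \<beta>" "\<beta> \<le> pi" for r \<beta>
  proof -
    have "pt r \<beta> \<in> K" using that by (simp add: K_def norm_sector_pt \<Phi>_sector_pt[OF d] sin_ge_zero)
    then have "h (pt r \<beta>) - w (pt r \<beta>) - \<epsilon> \<le> 0" by fact
    then show ?thesis unfolding h_def harmonic_extension_sector_pt[OF d] by simp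
  qed
  with p show thesis by (rule that)
qed

lemma first_mode_nonneg: "R \<ge> 0 \<Longrightarrow> first_mode R \<ge> 0"
  unfolding first_mode_def
  by (intro integral_nonneg integrable_continuous_interval continuous_intros continuous_w_pt)
    (auto intro!: mult_nonneg_nonneg w_pt_nonneg sin_ge_zero)

lemma integral_sin_perturb:
  assumes "continuous_on {0..pi} f" "continuous_on {0..pi} g" "\<And>\<beta>. 0 \<le> \<beta> \<Longrightarrow> \<beta> \<le> pi \<Longrightarrow> f \<beta> \<le> g \<beta> + \<epsilon>"
  shows "integral {0..pi} (\<lambda>\<beta>. f \<beta> * sin \<beta>) \<le> integral {0..pi} (\<lambda>\<beta>. g \<beta> * sin \<beta>) + 2 * \<epsilon>"
proof -
  have "integral {0..pi} (\<lambda>\<beta>. f \<beta> * sin \<beta>) \<le> integral {0..pi} (\<lambda>\<beta>. g \<beta> * sin \<beta> + \<epsilon> * sin \<beta>)"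
  proof (rule integral_le)
    fix \<beta> assume "\<beta> \<in> {0..pi}"
    then have "f \<beta> * sin \<beta> \<le> (g \<beta> + \<epsilon>) * sin \<beta>" using assms(3) by (intro mult_right_mono sin_ge_zero) auto
    then show "f \<beta> * sin \<beta> \<le> g \<beta> * sin \<beta> + \<epsilon> * sin \<beta>" by (simp add: distrib_right)
  qed (intro integrable_continuous_interval continuous_intros assms)+
  also have "\<dots> = integral {0..pi} (\<lambda>\<beta>. g \<beta> * sin \<beta>) + integral {0..pi} (\<lambda>\<beta>. \<epsilon> * sin \<beta>)"
    by (intro integral_add integrable_continuous_interval continuous_intros assms)
  also have "integral {0..pi} (\<lambda>\<beta>. \<epsilon> * sin \<beta>) = 2 * \<epsilon>"
    using has_integral_mult_right[OF has_integral_sin_0_pi, of \<epsilon>] by (simp add: has_integral_iff)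
  finally show ?thesis .
qed

text \<open>Pass to first modes in \<open>harmonic_minorant\<close>: the first mode of the harmonic minorant scales exactly
  like \<open>r\<^sup>d\<close>, while that of \<open>w\<close> on the smaller circle can only be larger.\<close>

lemma first_mode_mono:
  assumes "0 < r" "r \<le> R"
  shows "(r / R) ^ d * first_mode R \<le> first_mode r"
proof (rule field_le_epsilon)
  fix e :: real assume "e > 0"
  define \<epsilon> where "\<epsilon> = e / 4"
  define q where "q = (r / R) ^ d"
  have q: "0 \<le> q" "q \<le> 1" using assms by (auto simp: q_def power_le_one)
  obtain p where p: "\<And>k. Re (coeff p k) = 0" "\<And>\<beta>. \<bar>w (pt R \<beta>) - Re (poly p (cis \<beta>))\<bar> < \<epsilon>"
    "\<And>r \<beta>. 0 \<le> r \<Longrightarrow> r \<le> R \<Longrightarrow> 0 \<le> \<beta> \<Longrightarrow> \<beta> \<le> pi \<Longrightarrow> w (pt r \<beta>) \<ge> Re (poly p (of_real ((r / R) ^ d) * cis \<beta>)) - \<epsilon>"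
    using harmonic_minorant[of R \<epsilon>] assms \<open>e > 0\<close> by (auto simp: \<epsilon>_def)
  have "first_mode R \<le> integral {0..pi} (\<lambda>\<beta>. Re (poly p (cis \<beta>)) * sin \<beta>) + 2 * \<epsilon>"
    unfolding first_mode_def
  proof (intro integral_sin_perturb continuous_w_pt continuous_intros)
    show "w (pt R \<beta>) \<le> Re (poly p (cis \<beta>)) + \<epsilon>" for \<beta> using p(2)[of \<beta>] by (simp add: abs_less_iff)
  qed
  also have "integral {0..pi} (\<lambda>\<beta>. Re (poly p (cis \<beta>)) * sin \<beta>) = pi / 2 * (- Im (coeff p 1))"
    using imaginary_poly_sine_coeff[OF p(1), of 1 1] by (simp add: has_integral_iff)
  finally have "q * first_mode R \<le> q * (pi / 2 * (- Im (coeff p 1)) + 2 * \<epsilon>)" using q by (intro mult_left_mono)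
  also have "\<dots> \<le> q * (pi / 2 * (- Im (coeff p 1))) + 2 * \<epsilon>"
  proof -
    have "q * (2 * \<epsilon>) \<le> 1 * (2 * \<epsilon>)" using q \<open>e > 0\<close> by (intro mult_right_mono) (auto simp: \<epsilon>_def)
    then show ?thesis by (simp only: distrib_left)
  qed
  also have "q * (pi / 2 * (- Im (coeff p 1))) = integral {0..pi} (\<lambda>\<beta>. Re (poly p (of_real q * cis \<beta>)) * sin \<beta>)"
    using imaginary_poly_sine_coeff[OF p(1), of 1 q] by (simp add: has_integral_iff)
  also have "\<dots> \<le> first_mode r + 2 * \<epsilon>"
    unfolding first_mode_def
  proof (intro integral_sin_perturb continuous_w_pt continuous_intros)
    show "Re (poly p (of_real q * cis \<beta>)) \<le> w (pt r \<beta>) + \<epsilon>" if "0 \<le> \<beta>" "\<beta> \<le> pi" for \<beta>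
      using p(3)[of r \<beta>] that assms by (simp add: q_def)
  qed
  finally show "(r / R) ^ d * first_mode R \<le> first_mode r + e" by (simp add: q_def \<epsilon>_def)
qed

lemma w_ge_first_mode:
  assumes "0 \<le> r" "0 < R" "(r / R) ^ d \<le> 1 / 2" "0 \<le> \<beta>" "\<beta> \<le> pi"
  shows "2 / pi * (r / R) ^ d * sin \<beta> * ((1 - 24 * (r / R) ^ d) * first_mode R) \<le> w (pt r \<beta>)"
proof (rule field_le_epsilon)
  fix e :: real assume "e > 0"
  define q where "q = (r / R) ^ d"
  have q: "0 \<le> q" "q \<le> 1 / 2" using assms by (auto simp: q_def)
  define \<epsilon> where "\<epsilon> = e / 50"
  have "r \<le> R"
  proof (rule ccontr)
    assume "\<not> r \<le> R"
    then have "1 \<le> (r / R) ^ d" using assms by (intro one_le_power) auto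
    then show False using assms by simp
  qed
  define C where "C = 2 / pi * q * sin \<beta>"
  have C: "0 \<le> C" "C \<le> 1"
  proof -
    show "0 \<le> C" unfolding C_def using q assms by (intro mult_nonneg_nonneg) (auto simp: sin_ge_zero)
    have "C \<le> 2 / pi * (1 / 2) * 1" unfolding C_def using q assms
      by (intro mult_mono) (auto simp: sin_ge_zero)
    also have "\<dots> \<le> 1" using pi_gt3 by simp
    finally show "C \<le> 1" .
  qed
  obtain p where p: "\<And>k. Re (coeff p k) = 0" "\<And>\<beta>. \<bar>w (pt R \<beta>) - Re (poly p (cis \<beta>))\<bar> < \<epsilon>"
    "\<And>r \<beta>. 0 \<le> r \<Longrightarrow> r \<le> R \<Longrightarrow> 0 \<le> \<beta> \<Longrightarrow> \<beta> \<le> pi \<Longrightarrow> w (pt r \<beta>) \<ge> Re (poly p (of_real ((r / R) ^ d) * cis \<beta>)) - \<epsilon>"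
    using harmonic_minorant[of R \<epsilon>] assms \<open>e > 0\<close> by (auto simp: \<epsilon>_def)
  define I where "I = integral {0..pi} (\<lambda>\<beta>. Re (poly p (cis \<beta>)) * sin \<beta>)"
  define J where "J = integral {0..pi} (\<lambda>\<beta>. \<bar>Re (poly p (cis \<beta>))\<bar> * sin \<beta>)"
  have I: "first_mode R - 2 * \<epsilon> \<le> I"
  proof -
    have "first_mode R \<le> I + 2 * \<epsilon>" unfolding first_mode_def I_def
    proof (intro integral_sin_perturb continuous_w_pt continuous_intros)
      show "w (pt R \<beta>) \<le> Re (poly p (cis \<beta>)) + \<epsilon>" for \<beta> using p(2)[of \<beta>] by (simp add: abs_less_iff)
    qed
    then show ?thesis by simp
  qed
  have J: "J \<le> first_mode R + 2 * \<epsilon>" unfolding first_mode_def J_def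
  proof (intro integral_sin_perturb continuous_w_pt continuous_intros)
    show "\<bar>Re (poly p (cis \<beta>))\<bar> \<le> w (pt R \<beta>) + \<epsilon>" if "0 \<le> \<beta>" "\<beta> \<le> pi" for \<beta>
      using p(2)[of \<beta>] w_pt_nonneg[of R \<beta>] that assms by (auto simp: abs_if split: if_splits)
  qed
  have "24 * q * J \<le> 24 * q * (first_mode R + 2 * \<epsilon>)" using q J by (intro mult_left_mono) auto
  also have "\<dots> \<le> 24 * q * first_mode R + 24 * \<epsilon>"
  proof -
    have "q * \<epsilon> \<le> 1 / 2 * \<epsilon>" using q \<open>e > 0\<close> by (intro mult_right_mono) (auto simp: \<epsilon>_def)
    then show ?thesis by (simp add: distrib_left mult_ac)
  qed
  finally have "(1 - 24 * q) * first_mode R - 26 * \<epsilon> \<le> I - 24 * q * J"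
    using I by (simp add: algebra_simps)
  then have "C * ((1 - 24 * q) * first_mode R - 26 * \<epsilon>) \<le> C * (I - 24 * q * J)" using C by (intro mult_left_mono)
  also have "\<dots> \<le> Re (poly p (of_real q * cis \<beta>))"
    unfolding C_def I_def J_def by (rule imaginary_poly_lower_bound[OF p(1) q assms(4,5)])
  also have "\<dots> \<le> w (pt r \<beta>) + \<epsilon>" using p(3)[of r \<beta>] assms \<open>r \<le> R\<close> by (simp add: q_def)
  finally have "C * ((1 - 24 * q) * first_mode R) \<le> w (pt r \<beta>) + \<epsilon> + C * (26 * \<epsilon>)"
    by (simp add: right_diff_distrib)
  also have "C * (26 * \<epsilon>) \<le> 1 * (26 * \<epsilon>)" using C \<open>e > 0\<close> by (intro mult_right_mono) (auto simp: \<epsilon>_def)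
  finally show "2 / pi * (r / R) ^ d * sin \<beta> * ((1 - 24 * (r / R) ^ d) * first_mode R) \<le> w (pt r \<beta>) + e"
    unfolding C_def q_def using \<open>e > 0\<close> by (simp add: \<epsilon>_def)
qed

end

section \<open>Blow-down of the solution\<close>

lemma sin_ge_half:
  fixes x :: real
  assumes "0 \<le> x" "x \<le> pi / 3"
  shows "x / 2 \<le> sin x"
proof -
  have "sin 0 - 0 / 2 \<le> sin x - x / 2"
  proof (rule DERIV_nonneg_imp_nondecreasing[OF assms(1)])
    fix y assume y: "0 \<le> y" "y \<le> x"
    have "cos (pi / 3) \<le> cos y" using y assms by (intro cos_monotone_0_pi_le) auto
    then have "cos y - 1 / 2 \<ge> 0" by (simp add: cos_60)
    moreover have "((\<lambda>t. sin t - t / 2) has_real_derivative cos y - 1 / 2) (at y)"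
      by (auto intro!: derivative_eq_intros)
    ultimately show "\<exists>D. ((\<lambda>t. sin t - t / 2) has_real_derivative D) (at y) \<and> 0 \<le> D" by blast
  qed
  then show ?thesis by simp
qed

lemma sin_ge_on_middle:
  fixes \<eta> x :: real
  assumes "0 \<le> \<eta>" "\<eta> \<le> x" "x \<le> pi - \<eta>"
  shows "sin \<eta> \<le> sin x"
proof (cases "x \<le> pi / 2")
  case True
  then show ?thesis using assms by (intro sin_monotone_2pi_le) auto
next
  case False
  then have "sin \<eta> \<le> sin (pi - x)" using assms by (intro sin_monotone_2pi_le) auto
  then show ?thesis by simp
qed

text \<open>The available information on \<open>f\<close> carries the weight \<open>sin \<beta>\<close> and degenerates at the nodal lines.
  Strips of width \<open>\<eta>\<close> there are estimated by the supremum of \<open>f\<close> instead.\<close>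

lemma integral_le_of_weighted_bound:
  fixes f h :: "real \<Rightarrow> real"
  assumes \<eta>: "0 < \<eta>" "\<eta> \<le> pi / 2"
    and f: "continuous_on {0..pi} f" and h: "continuous_on {0..pi} h"
    and S: "\<And>\<beta>. 0 \<le> \<beta> \<Longrightarrow> \<beta> \<le> pi \<Longrightarrow> f \<beta> \<le> S"
    and h0: "\<And>\<beta>. 0 \<le> \<beta> \<Longrightarrow> \<beta> \<le> pi \<Longrightarrow> 0 \<le> h \<beta>"
    and fh: "\<And>\<beta>. 0 < \<beta> \<Longrightarrow> \<beta> < pi \<Longrightarrow> f \<beta> * sin \<beta> \<le> h \<beta>"
  shows "integral {0..pi} f \<le> 2 * \<eta> * S + integral {0..pi} h / sin \<eta>"
proof -
  have s\<eta>: "sin \<eta> > 0" using \<eta> by (intro sin_gt_zero) auto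
  have int: "f integrable_on {a..b}" "h integrable_on {a..b}" if "0 \<le> a" "b \<le> pi" for a b
    using that by (auto intro!: integrable_continuous_interval continuous_on_subset[OF f] continuous_on_subset[OF h])
  have end_bound: "integral {a..b} f \<le> (b - a) * S" if "0 \<le> a" "a \<le> b" "b \<le> pi" for a b
  proof -
    have "integral {a..b} f \<le> integral {a..b} (\<lambda>_. S)"
      using that S by (intro integral_le int) auto
    then show ?thesis using that by simp
  qed
  have "integral {\<eta>..pi - \<eta>} f \<le> integral {\<eta>..pi - \<eta>} (\<lambda>\<beta>. h \<beta> / sin \<eta>)"
  proof (rule integral_le)
    fix \<beta> assume \<beta>: "\<beta> \<in> {\<eta>..pi - \<eta>}"
    then have s: "sin \<eta> \<le> sin \<beta>" using \<eta> by (intro sin_ge_on_middle) auto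
    then have "f \<beta> \<le> h \<beta> / sin \<beta>" using fh[of \<beta>] \<beta> \<eta> s\<eta> by (simp add: field_simps)
    also have "\<dots> \<le> h \<beta> / sin \<eta>" using s s\<eta> h0[of \<beta>] \<beta> \<eta> by (intro divide_left_mono) auto
    finally show "f \<beta> \<le> h \<beta> / sin \<eta>" .
  qed (use \<eta> int in \<open>auto intro!: integrable_on_divide\<close>)
  also have "\<dots> = integral {\<eta>..pi - \<eta>} h / sin \<eta>" by simp
  also have "integral {\<eta>..pi - \<eta>} h \<le> integral {0..pi} h"
    using \<eta> h0 int by (intro integral_subset_le) auto
  finally have mid: "integral {\<eta>..pi - \<eta>} f \<le> integral {0..pi} h / sin \<eta>"
    using s\<eta> by (simp add: divide_right_mono)
  have "integral {0..pi} f = integral {0..\<eta>} f + (integral {\<eta>..pi - \<eta>} f + integral {pi - \<eta>..pi} f)"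
    using \<eta> by (subst Henstock_Kurzweil_Integration.integral_combine; (subst Henstock_Kurzweil_Integration.integral_combine)?)
      (auto intro!: int)
  also have "\<dots> \<le> (\<eta> - 0) * S + (integral {0..pi} h / sin \<eta> + (pi - (pi - \<eta>)) * S)"
    using \<eta> by (intro add_mono end_bound mid) auto
  finally show ?thesis by (simp add: algebra_simps)
qed

context symmetric_solution begin

text \<open>Normalised so that the function \<open>c * \<Phi>\<close> has slope \<open>c\<close> at every radius. The limit of the slope is
  the constant of the blow-down.\<close>

definition slope :: "real \<Rightarrow> real" where
  "slope R = 2 / pi * first_mode R / R ^ d"

definition slope_limit :: real where
  "slope_limit = Inf (slope ` {0<..})"

lemma first_mode_eq_slope: "R > 0 \<Longrightarrow> first_mode R = pi / 2 * slope R * R ^ d"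
  by (simp add: slope_def)

lemma slope_nonneg: "R \<ge> 0 \<Longrightarrow> slope R \<ge> 0"
  by (simp add: slope_def first_mode_nonneg)

lemma slope_antimono:
  assumes "0 < r" "r \<le> R"
  shows "slope R \<le> slope r"
  using first_mode_mono[OF assms] assms unfolding slope_def
  by (simp add: power_divide field_simps)

lemma slope_limit_le: "R > 0 \<Longrightarrow> slope_limit \<le> slope R"
  unfolding slope_limit_def by (intro cInf_lower bdd_belowI2[of _ 0]) (auto simp: slope_nonneg)

lemma slope_limit_nonneg: "slope_limit \<ge> 0"
  unfolding slope_limit_def by (intro cInf_greatest) (auto simp: slope_nonneg intro: exI[of _ 1])

lemma slope_tendsto: "(slope \<longlongrightarrow> slope_limit) at_top"
proof (rule order_tendstoI)
  fix a assume a: "a < slope_limit"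
  show "\<forall>\<^sub>F R in at_top. a < slope R"
    using eventually_gt_at_top[of 0]
  proof eventually_elim
    case (elim R)
    then show ?case using slope_limit_le[of R] a by linarith
  qed
next
  fix a assume "slope_limit < a"
  then obtain R0 where R0: "R0 > 0" "slope R0 < a"
    using cInf_lessD[of "slope ` {0<..}" a] by (auto simp: slope_limit_def intro: exI[of _ 1])
  show "\<forall>\<^sub>F R in at_top. slope R < a"
    using eventually_ge_at_top[of R0]
    by eventually_elim (use R0 slope_antimono in fastforce)
qed

text \<open>Let the outer radius in \<open>w_ge_first_mode\<close> tend to infinity: the contribution of the higher modes
  disappears and the slope converges.\<close>

lemma w_ge_slope_limit:
  assumes "0 \<le> r" "0 \<le> \<beta>" "\<beta> \<le> pi"
  shows "slope_limit * r ^ d * sin \<beta> \<le> w (pt r \<beta>)"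
proof (rule tendsto_upperbound)
  have "((\<lambda>R. r / R) \<longlongrightarrow> 0) at_top"
    by (intro tendsto_divide_0[OF tendsto_const] filterlim_at_top_imp_at_infinity filterlim_ident)
  then have q: "((\<lambda>R. (r / R) ^ d) \<longlongrightarrow> 0) at_top"
    using tendsto_power[of "\<lambda>R. r / R" 0 at_top d] d by (simp add: power_0_left)
  have "((\<lambda>R. r ^ d * sin \<beta> * ((1 - 24 * (r / R) ^ d) * slope R)) \<longlongrightarrow> r ^ d * sin \<beta> * ((1 - 24 * 0) * slope_limit)) at_top"
    by (intro tendsto_intros q slope_tendsto)
  then show "((\<lambda>R. r ^ d * sin \<beta> * ((1 - 24 * (r / R) ^ d) * slope R)) \<longlongrightarrow> slope_limit * r ^ d * sin \<beta>) at_top"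
    by (simp add: mult_ac)
  have "\<forall>\<^sub>F R in at_top. (r / R) ^ d < 1 / 2" using order_tendstoD(2)[OF q, of "1 / 2"] by simp
  then show "\<forall>\<^sub>F R in at_top. r ^ d * sin \<beta> * ((1 - 24 * (r / R) ^ d) * slope R) \<le> w (pt r \<beta>)"
    using eventually_gt_at_top[of 0]
  proof eventually_elim
    case (elim R)
    have "r ^ d * sin \<beta> * ((1 - 24 * (r / R) ^ d) * slope R) =
        2 / pi * (r / R) ^ d * sin \<beta> * ((1 - 24 * (r / R) ^ d) * first_mode R)"
      by (simp add: slope_def power_divide)
    also have "\<dots> \<le> w (pt r \<beta>)" using elim assms by (intro w_ge_first_mode) auto
    finally show ?case .
  qed
qed simp

lemma integral_u_pt: "integral {- pi..pi} (\<lambda>\<beta>. u (pt r \<beta>)) = integral {0..pi} (\<lambda>\<beta>. u (pt r \<beta>) + v (pt r \<beta>))"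
  using integral_symmetric_interval[OF continuous_u_pt, of pi r] by (simp add: v_pt)

text \<open>The integral of \<open>u\<close> over a circle is under control away from the nodal lines, by the first mode of
  \<open>w\<close> and the decay of \<open>v\<close>; near the nodal lines nothing but the supremum of \<open>u\<close> is at hand. To
  absorb that supremum, maximise \<open>(1 - (|z| / R)\<^sup>d)\<^sup>2 * u z\<close> over the disc of radius \<open>R\<close>. Around a
  maximum point \<open>z0\<close> the weight makes \<open>u\<close> at most \<open>4 * u z0\<close> on a slightly larger circle, so strips
  of small width contribute at most half of \<open>u z0\<close>. The exponent \<open>2\<close> matches the two losses of
  a factor \<open>1 / t\<close>: one from the distance to the larger circle and one from the strip width.\<close>

lemma u_growth:
  obtains C where "C > 0" "\<And>r \<beta>. r \<ge> 1 \<Longrightarrow> u (pt r \<beta>) \<le> C * r ^ d"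
proof -
  define B where "B = 3 * real d * 2 ^ d / 2"
  have "B > 0" using d by (simp add: B_def)
  define C0 where "C0 = 512 / pi\<^sup>2 * (pi / 2 * slope (1 / 2) + 4 * pi * B)"
  have "C0 > 0" unfolding C0_def using \<open>B > 0\<close> slope_nonneg[of "1 / 2"]
    by (intro mult_pos_pos add_nonneg_pos) auto
  have main: "(1 - (norm z / R) ^ d)\<^sup>2 * u z \<le> C0 * R ^ d" if R: "R \<ge> 1" and z: "z \<in> cball 0 R" for R z
  proof -
    define G where "G = (\<lambda>z. (1 - (norm z / R) ^ d)\<^sup>2 * u z)"
    have contG: "continuous_on (cball 0 R) G"
      unfolding G_def divide_inverse by (intro continuous_intros continuous_u)
    then obtain z0 where z0: "z0 \<in> cball 0 R" "\<And>y. y \<in> cball 0 R \<Longrightarrow> G y \<le> G z0"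
      using continuous_attains_sup[OF compact_cball _ contG] z by blast
    define t where "t = 1 - (norm z0 / R) ^ d"
    have t: "0 \<le> t" "t \<le> 1" using z0(1) R by (auto simp: t_def power_le_one)
    have "G z0 \<le> C0 * R ^ d"
    proof (cases "t = 0")
      case True
      then show ?thesis using \<open>C0 > 0\<close> R by (simp add: G_def t_def)
    next
      case False
      then have "t > 0" using t by simp
      \<comment> \<open>On the circle of radius \<open>R'\<close> the weight has dropped from \<open>t\<close> to \<open>t / 2\<close>.\<close>
      define s where "s = root d (1 - t / 2)"
      have sd: "s ^ d = 1 - t / 2" using d t by (simp add: s_def)
      have s0: "s \<ge> 0" "s \<le> 1" using d t by (auto simp: s_def)
      have "s ^ d \<le> s ^ 1" using s0 d by (intro power_decreasing) auto
      then have s: "1 / 2 \<le> s" using sd t by simp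
      define R' where "R' = R * s"
      have R': "R' > 0" "1 / 2 \<le> R'" "R' \<le> R"
        using R s s0 mult_mono[of 1 R "1 / 2" s] by (auto simp: R'_def mult_left_le)
      have R'R: "(R' / R) ^ d = 1 - t / 2" using R sd by (simp add: R'_def)
      have "(norm z0 / R) ^ d = 1 - t" by (simp add: t_def)
      also have "\<dots> < s ^ d" using \<open>t > 0\<close> by (simp add: sd)
      finally have "(norm z0 / R) ^ d < s ^ d" .
      then have "norm z0 / R < s" using s0(1) by (rule power_less_imp_less_base)
      then have z0R': "norm z0 < R'" using R by (simp add: R'_def divide_simps mult.commute)
      have bd: "u (pt R' \<beta>) \<le> 4 * u z0" for \<beta>
      proof -
        have "norm (pt R' \<beta>) = R'" using R' by (simp add: norm_sector_pt)
        then have "G (pt R' \<beta>) = (t / 2)\<^sup>2 * u (pt R' \<beta>)" using R'R by (simp add: G_def)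
        moreover have "G (pt R' \<beta>) \<le> t\<^sup>2 * u z0"
          using z0(2)[of "pt R' \<beta>"] R' \<open>norm (pt R' \<beta>) = R'\<close> by (simp add: G_def t_def)
        ultimately have "t\<^sup>2 * u (pt R' \<beta>) \<le> t\<^sup>2 * (4 * u z0)" by (simp add: power_divide)
        then show ?thesis using \<open>t > 0\<close> by simp
      qed
      obtain \<beta>0 where \<beta>0: "z0 = pt (norm z0) \<beta>0" using sector_pt_exhaust[OF d] .
      define I where "I = integral {- pi..pi} (\<lambda>\<beta>. u (pt R' \<beta>))"
      have "I \<ge> 0" unfolding I_def
        by (intro integral_nonneg integrable_continuous_interval continuous_u_pt) (simp add: u_pos less_imp_le)
      have "u (pt (norm z0) \<beta>0) \<le> I / (pi * (1 - (norm z0 / R') ^ d))"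
        unfolding I_def
      proof (rule subharmonic_le_integral[OF d, where f = u])
        show "\<exists>L\<ge>0. has_laplacian u L z" for z
          using lap_u[of z] u_pos[of z] by (intro exI[of _ "u z * (v z)\<^sup>2"]) (simp add: less_imp_le)
        show "u (pt R' (\<beta> + 2 * pi)) = u (pt R' \<beta>)" for \<beta> by (rule u_pt_periodic)
      qed (use z0R' u_pos in \<open>auto intro: less_imp_le continuous_u continuous_u_pt\<close>)
      also have "\<dots> \<le> I / (pi * (t / 2))"
      proof -
        have "(norm z0 / R') ^ d = (norm z0 / R) ^ d / s ^ d"
          using R by (simp add: R'_def power_divide power_mult_distrib)
        then have "(norm z0 / R') ^ d = (1 - t) / (1 - t / 2)" by (simp add: sd t_def)
        moreover have "(1 - t) / (1 - t / 2) \<le> 1 - t / 2"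
          using t by (simp add: divide_simps) (simp add: algebra_simps power2_eq_square)
        ultimately have "(norm z0 / R') ^ d \<le> 1 - t / 2" by (simp only:)
        then have "t / 2 \<le> 1 - (norm z0 / R') ^ d" by linarith
        then show ?thesis using \<open>t > 0\<close> \<open>I \<ge> 0\<close> by (intro divide_left_mono mult_left_mono mult_pos_pos) auto
      qed
      finally have uz0: "u z0 \<le> I / (pi * (t / 2))" using \<beta>0 by simp
      \<comment> \<open>With this width the strips contribute exactly \<open>u z0 / 2\<close> to the bound for \<open>u z0\<close>.\<close>
      define \<eta> where "\<eta> = pi * t / 64"
      have \<eta>: "0 < \<eta>" "\<eta> \<le> pi / 2" "\<eta> \<le> pi / 3" using \<open>t > 0\<close> t by (auto simp: \<eta>_def)
      have s\<eta>: "pi * t / 128 \<le> sin \<eta>" using sin_ge_half[of \<eta>] \<eta> by (simp add: \<eta>_def)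
      have "I \<le> 2 * \<eta> * (8 * u z0) + integral {0..pi} (\<lambda>\<beta>. w (pt R' \<beta>) * sin \<beta> + 2 * B / R') / sin \<eta>"
        unfolding I_def integral_u_pt
      proof (rule integral_le_of_weighted_bound[OF \<eta>(1,2)])
        show "u (pt R' \<beta>) + v (pt R' \<beta>) \<le> 8 * u z0" for \<beta>
          using bd[of \<beta>] bd[of "- \<beta>"] by (simp add: v_pt)
        show "0 \<le> w (pt R' \<beta>) * sin \<beta> + 2 * B / R'" if "0 \<le> \<beta>" "\<beta> \<le> pi" for \<beta>
          using that R' \<open>B > 0\<close> by (intro add_nonneg_nonneg mult_nonneg_nonneg w_pt_nonneg sin_ge_zero) auto
        show "(u (pt R' \<beta>) + v (pt R' \<beta>)) * sin \<beta> \<le> w (pt R' \<beta>) * sin \<beta> + 2 * B / R'" if "0 < \<beta>" "\<beta> < pi" for \<beta>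
        proof -
          have "sin \<beta> > 0" using that by (rule sin_gt_zero)
          then have "v (pt R' \<beta>) * sin \<beta> \<le> B / R'"
            using v_decay[OF R'(1) that] R'(1) by (simp add: B_def field_simps)
          moreover have "(u (pt R' \<beta>) + v (pt R' \<beta>)) * sin \<beta> = w (pt R' \<beta>) * sin \<beta> + 2 * (v (pt R' \<beta>) * sin \<beta>)"
            by (simp add: w_def algebra_simps)
          moreover have "2 * B / R' = 2 * (B / R')" by simp
          ultimately show ?thesis by linarith
        qed
      qed (intro continuous_intros continuous_u_pt continuous_v_pt continuous_w_pt)+
      also have "integral {0..pi} (\<lambda>\<beta>. w (pt R' \<beta>) * sin \<beta> + 2 * B / R') = first_mode R' + pi * (2 * B / R')"
        unfolding first_mode_def
        by (subst integral_add) (auto intro!: integrable_continuous_interval continuous_intros continuous_w_pt)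
      also have "(first_mode R' + pi * (2 * B / R')) / sin \<eta> \<le> (pi / 2 * slope (1 / 2) * R ^ d + 4 * pi * B * R ^ d) / (pi * t / 128)"
      proof (intro frac_le add_mono s\<eta>)
        have "first_mode R' = pi / 2 * slope R' * R' ^ d" using R' by (intro first_mode_eq_slope)
        also have "\<dots> \<le> pi / 2 * slope (1 / 2) * R ^ d"
          using R' slope_antimono[of "1 / 2" R'] slope_nonneg[of "1 / 2"] by (intro mult_mono power_mono) (auto intro: slope_nonneg)
        finally show "first_mode R' \<le> pi / 2 * slope (1 / 2) * R ^ d" .
        have "2 * B / R' \<le> 2 * B / (1 / 2)" using R' \<open>B > 0\<close> by (intro divide_left_mono) auto
        then have "pi * (2 * B / R') \<le> pi * (4 * B)" by (intro mult_left_mono) auto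
        also have "\<dots> \<le> pi * (4 * B) * R ^ d" using R \<open>B > 0\<close> by simp
        finally show "pi * (2 * B / R') \<le> 4 * pi * B * R ^ d" by (simp add: mult_ac)
        show "0 \<le> pi / 2 * slope (1 / 2) * R ^ d + 4 * pi * B * R ^ d"
          using R \<open>B > 0\<close> slope_nonneg[of "1 / 2"] by simp
      qed (use \<open>t > 0\<close> in auto)
      also have "(pi / 2 * slope (1 / 2) * R ^ d + 4 * pi * B * R ^ d) / (pi * t / 128) = pi * C0 * R ^ d / (4 * t)"
        using \<open>t > 0\<close> by (simp add: C0_def power2_eq_square field_simps)
      finally have "I \<le> 16 * \<eta> * u z0 + pi * C0 * R ^ d / (4 * t)" by simp
      then have "I / (pi * (t / 2)) \<le> (16 * \<eta> * u z0 + pi * C0 * R ^ d / (4 * t)) / (pi * (t / 2))"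
        using \<open>t > 0\<close> by (intro divide_right_mono) auto
      also have "\<dots> = u z0 / 2 + C0 * R ^ d / (2 * t\<^sup>2)"
        using \<open>t > 0\<close> by (simp add: \<eta>_def field_simps power2_eq_square)
      finally have "u z0 \<le> u z0 / 2 + C0 * R ^ d / (2 * t\<^sup>2)" using uz0 by linarith
      then have "u z0 \<le> C0 * R ^ d / t\<^sup>2" by simp
      then have "t\<^sup>2 * u z0 \<le> C0 * R ^ d" using \<open>t > 0\<close> by (simp add: field_simps)
      then show ?thesis by (simp add: G_def t_def)
    qed
    then show ?thesis using z0(2)[OF z] by (simp add: G_def)
  qed
  show thesis
  proof (rule that[of "4 * C0 * 2 ^ d"])
    show "4 * C0 * 2 ^ d > 0" using \<open>C0 > 0\<close> by simp
    fix r \<beta> :: real assume r: "r \<ge> 1"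
    have "(1 / 2 :: real) ^ d \<le> (1 / 2) ^ 1" using d by (intro power_decreasing) auto
    then have "1 / 2 \<le> 1 - (norm (pt r \<beta>) / (2 * r)) ^ d" using r by (simp add: norm_sector_pt)
    then have "(1 / 2)\<^sup>2 \<le> (1 - (norm (pt r \<beta>) / (2 * r)) ^ d)\<^sup>2" by (intro power_mono) auto
    then have "(1 / 2)\<^sup>2 * u (pt r \<beta>) \<le> (1 - (norm (pt r \<beta>) / (2 * r)) ^ d)\<^sup>2 * u (pt r \<beta>)"
      using u_pos[of "pt r \<beta>"] by (intro mult_right_mono) auto
    also have "\<dots> \<le> C0 * (2 * r) ^ d" using r by (intro main) (auto simp: norm_sector_pt)
    finally show "u (pt r \<beta>) \<le> 4 * C0 * 2 ^ d * r ^ d" by (simp add: power_mult_distrib power2_eq_square)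
  qed
qed

text \<open>The \<open>L\<^sup>1\<close> distance, over one period of \<open>\<beta>\<close> on the circle, of \<open>u\<close> from the profile
  \<open>slope_limit * max \<Phi> 0\<close>; the integrand is nonnegative by \<open>w_ge_slope_limit\<close>.\<close>

definition defect :: "real \<Rightarrow> real" where
  "defect R = integral {0..pi} (\<lambda>\<beta>. (w (pt R \<beta>) - slope_limit * R ^ d * sin \<beta>) + 2 * v (pt R \<beta>))"

lemma has_integral_sin_square: "((\<lambda>\<beta>. sin \<beta> * sin \<beta>) has_integral pi / 2) {0..pi}"
  using imaginary_poly_sine_coeff[of "[:0, - \<i>:]" 1 1] by (simp add: coeff_pCons split: nat.splits)

text \<open>Since \<open>w - slope_limit * \<Phi>\<close> is nonnegative, convergence of its weighted integral \<open>slope - slope_limit\<close>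
  to zero is already convergence in weighted \<open>L\<^sup>1\<close>. The growth bound handles the strips at the nodal
  lines.\<close>

lemma defect_small:
  assumes "\<epsilon> > 0"
  shows "\<forall>\<^sub>F R in at_top. defect R \<le> \<epsilon> * R ^ d"
proof -
  define c where "c = slope_limit"
  have "c \<ge> 0" by (simp add: c_def slope_limit_nonneg)
  define B where "B = 3 * real d * 2 ^ d / 2"
  have "B > 0" using d by (simp add: B_def)
  obtain C where C: "C > 0" "\<And>r \<beta>. r \<ge> 1 \<Longrightarrow> u (pt r \<beta>) \<le> C * r ^ d" using u_growth by blast
  define \<eta> where "\<eta> = min 1 (\<epsilon> / (8 * C))"
  have \<eta>: "0 < \<eta>" "\<eta> \<le> 1" "4 * \<eta> * C \<le> \<epsilon> / 2" using assms C(1) by (auto simp: \<eta>_def min_def field_simps)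
  then have "\<eta> \<le> pi / 2" using pi_gt3 by simp
  have s\<eta>: "sin \<eta> > 0" using \<eta> \<open>\<eta> \<le> pi / 2\<close> by (intro sin_gt_zero) auto
  have "((\<lambda>R. (pi / 2 * (slope R - c) + 2 * pi * B / R) / sin \<eta>) \<longlongrightarrow> (pi / 2 * (c - c) + 0) / sin \<eta>) at_top"
    unfolding c_def
    by (intro tendsto_intros slope_tendsto tendsto_divide_0[OF tendsto_const]
        filterlim_at_top_imp_at_infinity filterlim_ident) (use s\<eta> in auto)
  then have "\<forall>\<^sub>F R in at_top. (pi / 2 * (slope R - c) + 2 * pi * B / R) / sin \<eta> < \<epsilon> / 2"
    using assms by (intro order_tendstoD(2)) auto
  then show ?thesis using eventually_ge_at_top[of 1]
  proof eventually_elim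
    case (elim R)
    then have R: "R \<ge> 1" "R > 0" by auto
    have Rd: "1 \<le> R ^ d" using R by (simp add: one_le_power)
    have "defect R \<le> 2 * \<eta> * (2 * C * R ^ d) +
        integral {0..pi} (\<lambda>\<beta>. (w (pt R \<beta>) - c * R ^ d * sin \<beta>) * sin \<beta> + 2 * B / R) / sin \<eta>"
      unfolding defect_def c_def[symmetric]
    proof (rule integral_le_of_weighted_bound[OF \<eta>(1) \<open>\<eta> \<le> pi / 2\<close>])
      fix \<beta> assume \<beta>: "0 \<le> \<beta>" "\<beta> \<le> pi"
      have "0 \<le> c * R ^ d * sin \<beta>" using \<beta> R \<open>c \<ge> 0\<close> by (intro mult_nonneg_nonneg sin_ge_zero) auto
      then show "(w (pt R \<beta>) - c * R ^ d * sin \<beta>) + 2 * v (pt R \<beta>) \<le> 2 * C * R ^ d"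
        using C(2)[OF R(1), of \<beta>] C(2)[OF R(1), of "- \<beta>"] by (simp add: w_def v_pt)
      show "0 \<le> (w (pt R \<beta>) - c * R ^ d * sin \<beta>) * sin \<beta> + 2 * B / R"
        using w_ge_slope_limit[of R \<beta>] \<beta> R \<open>B > 0\<close> unfolding c_def[symmetric]
        by (intro add_nonneg_nonneg mult_nonneg_nonneg sin_ge_zero) auto
    next
      fix \<beta> assume \<beta>: "0 < \<beta>" "\<beta> < pi"
      have "sin \<beta> > 0" using \<beta> by (rule sin_gt_zero)
      then have "v (pt R \<beta>) * sin \<beta> \<le> B / R"
        using v_decay[OF R(2) \<beta>] R(2) by (simp add: B_def field_simps)
      then show "((w (pt R \<beta>) - c * R ^ d * sin \<beta>) + 2 * v (pt R \<beta>)) * sin \<beta> \<le> (w (pt R \<beta>) - c * R ^ d * sin \<beta>) * sin \<beta> + 2 * B / R"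
        by (simp add: distrib_right)
    qed (intro continuous_intros continuous_v_pt continuous_w_pt)+
    also have "integral {0..pi} (\<lambda>\<beta>. (w (pt R \<beta>) - c * R ^ d * sin \<beta>) * sin \<beta> + 2 * B / R) =
        R ^ d * (pi / 2 * (slope R - c)) + 2 * pi * B / R"
    proof -
      have "((\<lambda>\<beta>. w (pt R \<beta>) * sin \<beta>) has_integral first_mode R) {0..pi}"
        unfolding first_mode_def by (intro integrable_integral integrable_continuous_interval continuous_intros continuous_w_pt)
      from has_integral_diff[OF this has_integral_mult_right[OF has_integral_sin_square, of "c * R ^ d"]]
      have "((\<lambda>\<beta>. (w (pt R \<beta>) - c * R ^ d * sin \<beta>) * sin \<beta>) has_integral (first_mode R - c * R ^ d * (pi / 2))) {0..pi}"
        by (simp add: left_diff_distrib mult.assoc)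
      from has_integral_add[OF this has_integral_const_real[of "2 * B / R" 0 pi]] show ?thesis
        using R by (simp add: has_integral_iff first_mode_eq_slope algebra_simps)
    qed
    also have "(R ^ d * (pi / 2 * (slope R - c)) + 2 * pi * B / R) / sin \<eta> \<le>
        R ^ d * ((pi / 2 * (slope R - c) + 2 * pi * B / R) / sin \<eta>)"
    proof -
      have "1 * (2 * pi * B / R) \<le> R ^ d * (2 * pi * B / R)" using Rd R \<open>B > 0\<close> by (intro mult_right_mono) auto
      then have "R ^ d * (pi / 2 * (slope R - c)) + 2 * pi * B / R \<le> R ^ d * (pi / 2 * (slope R - c) + 2 * pi * B / R)"
        by (simp only: distrib_left mult_1)
      then have "(R ^ d * (pi / 2 * (slope R - c)) + 2 * pi * B / R) / sin \<eta> \<le>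
          R ^ d * (pi / 2 * (slope R - c) + 2 * pi * B / R) / sin \<eta>"
        using s\<eta> by (intro divide_right_mono) auto
      then show ?thesis by (simp only: times_divide_eq_right)
    qed
    also have "\<dots> \<le> R ^ d * (\<epsilon> / 2)" using elim(1) R by (intro mult_left_mono) auto
    also have "2 * \<eta> * (2 * C * R ^ d) = (4 * \<eta> * C) * R ^ d" by simp
    also have "\<dots> \<le> \<epsilon> / 2 * R ^ d" using \<eta>(3) R by (intro mult_right_mono) auto
    finally show ?case by simp
  qed
qed


lemma u_ge_limit: "slope_limit * (r ^ d * max 0 (sin \<beta>)) \<le> u (pt r \<beta>)" if "r \<ge> 0"
proof (cases "sin \<beta> > 0")
  case True
  define \<beta>' where "\<beta>' = Arg (cis \<beta>)"
  have cis: "cis \<beta>' = cis \<beta>" by (simp add: \<beta>'_def cis_Arg sgn_div_norm)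
  then have s: "sin \<beta>' = sin \<beta>" by (simp add: complex_eq_iff)
  have b: "- pi < \<beta>'" "\<beta>' \<le> pi" using Arg_bounded[of "cis \<beta>"] by (auto simp: \<beta>'_def)
  have "\<beta>' \<ge> 0"
  proof (rule ccontr)
    assume "\<not> \<beta>' \<ge> 0"
    then have "sin (- \<beta>') > 0" using b by (intro sin_gt_zero) auto
    then show False using s True by simp
  qed
  then have "slope_limit * r ^ d * sin \<beta>' \<le> w (pt r \<beta>')" using b that by (intro w_ge_slope_limit)
  also have "\<dots> \<le> u (pt r \<beta>')" using v_pos[of "pt r \<beta>'"] by (simp add: w_def)
  also have "u (pt r \<beta>') = u (pt r \<beta>)"
    by (rule cis_eq_imp_periodic_eq[of "\<lambda>\<beta>. u (pt r \<beta>)", OF u_pt_periodic cis])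
  finally show ?thesis using True by (simp add: s mult.assoc)
next
  case False
  then show ?thesis using u_pos[of "pt r \<beta>"] by (simp add: max_def)
qed

text \<open>Apply \<open>subharmonic_le_integral\<close> to \<open>u\<close> minus the harmonic extension of an approximate profile. The
  approximation error is subtracted beforehand, so that only the defect is multiplied by the large
  factor \<open>1 / (1 - (r / R)\<^sup>d)\<close>.\<close>

lemma u_le_harmonic_plus_defect:
  assumes p: "\<And>\<beta>. \<bar>max 0 (sin \<beta>) - Re (poly p (cis \<beta>))\<bar> < \<epsilon>"
    and r: "0 \<le> r" "r < R"
  shows "u (pt r \<beta>) \<le> slope_limit * R ^ d * (Re (poly p (of_real ((r / R) ^ d) * cis \<beta>)) + \<epsilon>) +
    defect R / (pi * (1 - (r / R) ^ d))"
proof -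
  define c where "c = slope_limit"
  have c: "c \<ge> 0" by (simp add: c_def slope_limit_nonneg)
  have "R > 0" using r by simp
  define f where "f = (\<lambda>z. u z - c * R ^ d * Re (poly p (\<i> * z ^ d / of_real (R ^ d))) - c * R ^ d * \<epsilon>)"
  define g where "g = (\<lambda>\<beta>. \<bar>u (pt R \<beta>) - c * R ^ d * max 0 (sin \<beta>)\<bar>)"
  have contg: "continuous_on S g" for S unfolding g_def by (intro continuous_intros continuous_u_pt)
  have "f (pt r \<beta>) \<le> integral {- pi..pi} g / (pi * (1 - (r / R) ^ d))"
  proof (rule subharmonic_le_integral[OF d r _ _ contg])
    show "continuous_on (cball 0 R) f"
      unfolding f_def
      by (intro continuous_on_diff continuous_on_mult continuous_u continuous_on_harmonic_extension continuous_on_const)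
    show "\<exists>L\<ge>0. has_laplacian f L z" for z
    proof (intro exI conjI)
      show "0 \<le> u z * (v z)\<^sup>2 - c * R ^ d * 0 - 0" using u_pos[of z] by simp
      show "has_laplacian f (u z * (v z)\<^sup>2 - c * R ^ d * 0 - 0) z"
        unfolding f_def
        by (rule has_laplacian_diff[OF has_laplacian_diff[OF lap_u has_laplacian_cmult[OF has_laplacian_harmonic_extension]] has_laplacian_const])
    qed
    show "g (\<beta> + 2 * pi) = g \<beta>" for \<beta> unfolding g_def u_pt_periodic by simp
    show "g \<beta> \<ge> 0" for \<beta> by (simp add: g_def)
    show "f (pt R \<beta>) \<le> g \<beta>" for \<beta>
    proof -
      have "f (pt R \<beta>) = u (pt R \<beta>) - c * R ^ d * (Re (poly p (cis \<beta>)) + \<epsilon>)"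
        using \<open>R > 0\<close> unfolding f_def harmonic_extension_sector_pt[OF d] by (simp add: distrib_left)
      also have "\<dots> \<le> u (pt R \<beta>) - c * R ^ d * max 0 (sin \<beta>)"
        using p[of \<beta>] c \<open>R > 0\<close> by (intro diff_left_mono mult_left_mono) (auto simp: abs_less_iff)
      finally show ?thesis unfolding g_def by linarith
    qed
  qed
  also have "integral {- pi..pi} g = defect R"
  proof -
    have "integral {- pi..pi} g = integral {0..pi} (\<lambda>\<beta>. g \<beta> + g (- \<beta>))"
      by (intro integral_symmetric_interval contg) simp
    also have "\<dots> = defect R"
      unfolding defect_def
    proof (rule Henstock_Kurzweil_Integration.integral_cong)
      fix \<beta> assume "\<beta> \<in> {0..pi}"
      then have \<beta>: "0 \<le> \<beta>" "\<beta> \<le> pi" by auto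
      have s: "sin \<beta> \<ge> 0" using \<beta> by (rule sin_ge_zero)
      have "g \<beta> = u (pt R \<beta>) - c * R ^ d * sin \<beta>"
        using w_ge_slope_limit[of R \<beta>] \<beta> s \<open>R > 0\<close> v_pos[of "pt R \<beta>"] by (simp add: g_def w_def c_def)
      moreover have "g (- \<beta>) = v (pt R \<beta>)"
        using s v_pos[of "pt R \<beta>"] by (simp add: g_def v_pt)
      ultimately show "g \<beta> + g (- \<beta>) = (w (pt R \<beta>) - slope_limit * R ^ d * sin \<beta>) + 2 * v (pt R \<beta>)"
        by (simp add: w_def c_def)
    qed
    finally show ?thesis .
  qed
  finally show ?thesis
    unfolding f_def c_def harmonic_extension_sector_pt[OF d] by (simp add: distrib_left)
qed

text \<open>Order of choices: first the approximation \<open>p\<close> of the profile \<open>max 0 (sin \<beta>)\<close>, then a ratio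
  \<open>q = (r / R)\<^sup>d\<close> so close to \<open>1\<close> that the harmonic extension of \<open>p\<close> has hardly changed between the
  two circles, and finally a radius so large that the defect is small compared with \<open>1 - q\<close>.\<close>

lemma u_le_limit:
  assumes "\<epsilon> > 0"
  shows "\<forall>\<^sub>F r in at_top. \<forall>\<beta>. u (pt r \<beta>) \<le> slope_limit * (r ^ d * max 0 (sin \<beta>)) + \<epsilon> * r ^ d"
proof -
  define c where "c = slope_limit"
  have c: "c \<ge> 0" by (simp add: c_def slope_limit_nonneg)
  \<comment> \<open>The errors below add up to \<open>\<delta> (7 c + 2) r\<^sup>d\<close>.\<close>
  define \<delta> where "\<delta> = min 1 (\<epsilon> / (7 * c + 2))"
  have "\<delta> \<le> \<epsilon> / (7 * c + 2)" by (simp add: \<delta>_def)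
  then have "\<delta> * (7 * c + 2) \<le> \<epsilon>" using c by (simp add: pos_le_divide_eq)
  moreover have "0 < \<delta>" "\<delta> \<le> 1" using assms c by (auto simp: \<delta>_def)
  ultimately have \<delta>: "0 < \<delta>" "\<delta> \<le> 1" "\<delta> * (7 * c + 2) \<le> \<epsilon>" by blast+
  have "continuous_on UNIV (\<lambda>\<beta>::real. max 0 (sin \<beta>))" by (intro continuous_on_max continuous_intros)
  moreover have "max 0 (sin (\<beta> + 2 * pi)) = max 0 (sin \<beta>)" for \<beta> :: real by simp
  ultimately obtain p where p: "\<And>\<beta>. \<bar>max 0 (sin \<beta>) - Re (poly p (cis \<beta>))\<bar> < \<delta>"
    using trig_approx[of "\<lambda>\<beta>. max 0 (sin \<beta>)" \<delta>] \<delta>(1) by blast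
  have "((\<lambda>q. \<Sum>k\<le>degree p. norm (coeff p k) * (1 - q ^ k)) \<longlongrightarrow> (\<Sum>k\<le>degree p. norm (coeff p k) * (1 - 1 ^ k))) (at_left (1::real))"
    by (intro tendsto_intros)
  then have "\<forall>\<^sub>F q in at_left (1::real). (\<Sum>k\<le>degree p. norm (coeff p k) * (1 - q ^ k)) < \<delta>"
    using \<delta>(1) by (intro order_tendstoD(2)) auto
  moreover have "((\<lambda>q. 1 / q) \<longlongrightarrow> 1 / 1) (at_left (1::real))" by (intro tendsto_intros) auto
  then have "\<forall>\<^sub>F q in at_left (1::real). 1 / q < 1 + \<delta>" using \<delta>(1) by (intro order_tendstoD(2)) auto
  moreover have "\<forall>\<^sub>F q in at_left (1::real). q \<in> {0<..<1}" by (intro eventually_at_leftI[of 0]) auto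
  ultimately have ev: "\<forall>\<^sub>F q in at_left (1::real). (\<Sum>k\<le>degree p. norm (coeff p k) * (1 - q ^ k)) < \<delta> \<and> 1 / q < 1 + \<delta> \<and> q \<in> {0<..<1}"
    by eventually_elim auto
  then obtain q where q: "(\<Sum>k\<le>degree p. norm (coeff p k) * (1 - q ^ k)) < \<delta>" "1 / q < 1 + \<delta>" "0 < q" "q < 1"
    using eventually_happens[OF ev] by auto
  define s where "s = root d q"
  have s: "0 < s" "s < 1" "s ^ d = q" using q d by (auto simp: s_def)
  have "\<forall>\<^sub>F R in at_top. defect R \<le> (\<delta> * (1 - q)) * R ^ d" using \<delta> q by (intro defect_small) simp
  moreover have "filterlim (\<lambda>r. r / s) at_top at_top"
    using s filterlim_tendsto_pos_mult_at_top[OF tendsto_const[of "1 / s"] _ filterlim_ident] by simp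
  ultimately have "\<forall>\<^sub>F r in at_top. defect (r / s) \<le> (\<delta> * (1 - q)) * (r / s) ^ d"
    by (rule eventually_compose_filterlim)
  then show ?thesis using eventually_gt_at_top[of 0]
  proof eventually_elim
    case (elim r)
    define R where "R = r / s"
    have R: "R > 0" "r < R" using elim(2) s by (auto simp: R_def field_simps)
    have rR: "(r / R) ^ d = q" using elim(2) s by (simp add: R_def)
    have Rd: "R ^ d = r ^ d / q" using s by (simp add: R_def power_divide)
    have Rle: "R ^ d \<le> (1 + \<delta>) * r ^ d"
    proof -
      have "r ^ d * (1 / q) \<le> r ^ d * (1 + \<delta>)" using q(2) elim(2) by (intro mult_left_mono) auto
      then show ?thesis by (simp add: Rd mult.commute)
    qed
    show ?case
    proof
      fix \<beta>
      have poly_le: "Re (poly p (of_real q * cis \<beta>)) \<le> max 0 (sin \<beta>) + 2 * \<delta>"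
      proof -
        have "Re (poly p (of_real q * cis \<beta>)) - Re (poly p (cis \<beta>)) =
            (\<Sum>k\<le>degree p. (q ^ k - 1) * Re (coeff p k * cis (real k * \<beta>)))"
          using Re_poly_polar[of p q \<beta>] Re_poly_polar[of p 1 \<beta>] by (simp only: of_real_1 mult_1 power_one left_diff_distrib sum_subtractf)
        also have "\<dots> \<le> (\<Sum>k\<le>degree p. norm (coeff p k) * (1 - q ^ k))"
        proof (rule sum_mono)
          fix k
          have qk: "q ^ k \<le> 1" using q by (simp add: power_le_one)
          have "- Re (coeff p k * cis (real k * \<beta>)) \<le> norm (coeff p k * cis (real k * \<beta>))"
            using abs_Re_le_cmod[of "coeff p k * cis (real k * \<beta>)"] by linarith
          also have "\<dots> = norm (coeff p k)" by (simp add: norm_mult)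
          finally have "(1 - q ^ k) * (- Re (coeff p k * cis (real k * \<beta>))) \<le> (1 - q ^ k) * norm (coeff p k)"
            using qk by (intro mult_left_mono) auto
          moreover have "(q ^ k - 1) * Re (coeff p k * cis (real k * \<beta>)) = (1 - q ^ k) * (- Re (coeff p k * cis (real k * \<beta>)))"
            by (simp only: algebra_simps)
          ultimately show "(q ^ k - 1) * Re (coeff p k * cis (real k * \<beta>)) \<le> norm (coeff p k) * (1 - q ^ k)"
            by (simp only: mult.commute)
        qed
        finally show ?thesis using q(1) p[of \<beta>] by linarith
      qed
      have cR: "c * R ^ d \<ge> 0" using c R by simp
      have "u (pt r \<beta>) \<le> c * R ^ d * (Re (poly p (of_real q * cis \<beta>)) + \<delta>) + defect R / (pi * (1 - q))"
        using u_le_harmonic_plus_defect[OF p, of r R \<beta>] elim(2) R by (simp only: rR c_def)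
      also have "c * R ^ d * (Re (poly p (of_real q * cis \<beta>)) + \<delta>) \<le> c * R ^ d * (max 0 (sin \<beta>) + 3 * \<delta>)"
        using poly_le cR by (intro mult_left_mono) auto
      also have "defect R / (pi * (1 - q)) \<le> \<delta> * R ^ d"
      proof -
        have "defect R \<le> \<delta> * R ^ d * (1 * (1 - q))" using elim(1) by (simp add: R_def mult_ac)
        also have "\<dots> \<le> \<delta> * R ^ d * (pi * (1 - q))"
          using q \<delta> R pi_gt3 by (intro mult_left_mono mult_right_mono) auto
        finally show ?thesis using q by (simp add: field_simps)
      qed
      also have "c * R ^ d * (max 0 (sin \<beta>) + 3 * \<delta>) + \<delta> * R ^ d = R ^ d * (c * max 0 (sin \<beta>) + \<delta> * (3 * c + 1))"
        by (simp add: algebra_simps)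
      also have "\<dots> \<le> ((1 + \<delta>) * r ^ d) * (c * max 0 (sin \<beta>) + \<delta> * (3 * c + 1))"
        using Rle c \<delta> by (intro mult_right_mono) auto
      also have "\<dots> = c * (r ^ d * max 0 (sin \<beta>)) + r ^ d * (\<delta> * (c * max 0 (sin \<beta>)) + (1 + \<delta>) * (\<delta> * (3 * c + 1)))"
        by (simp add: algebra_simps)
      also have "\<dots> \<le> c * (r ^ d * max 0 (sin \<beta>)) + r ^ d * (\<delta> * (c * 1) + (1 + 1) * (\<delta> * (3 * c + 1)))"
        using c \<delta> elim(2) by (intro add_left_mono mult_left_mono add_mono mult_right_mono) auto
      also have "\<delta> * (c * 1) + (1 + 1) * (\<delta> * (3 * c + 1)) = \<delta> * (7 * c + 2)"
        by (simp add: algebra_simps)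
      also have "r ^ d * (\<delta> * (7 * c + 2)) \<le> r ^ d * \<epsilon>" using \<delta>(3) elim(2) by (intro mult_left_mono) auto
      finally show "u (pt r \<beta>) \<le> slope_limit * (r ^ d * max 0 (sin \<beta>)) + \<epsilon> * r ^ d"
        by (simp add: c_def mult.commute)
    qed
  qed
qed

lemma \<Phi>_pos_pt: "r \<ge> 0 \<Longrightarrow> \<Phi>_pos d (pt r \<beta>) = r ^ d * max 0 (sin \<beta>)"
  by (simp add: \<Phi>_pos_def \<Phi>_sector_pt[OF d] max_mult_distrib_left max.commute)

lemma \<Phi>_neg_pt: "r \<ge> 0 \<Longrightarrow> \<Phi>_neg d (pt r \<beta>) = \<Phi>_pos d (pt r (- \<beta>))"
  by (simp add: \<Phi>_neg_def \<Phi>_pos_def \<Phi>_sector_pt[OF d])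

lemma asymptotic_profile:
  assumes "\<epsilon> > 0"
  obtains B where "B \<ge> 0"
    "\<And>z. \<bar>u z - slope_limit * \<Phi>_pos d z\<bar> \<le> \<epsilon> * norm z ^ d + B"
    "\<And>z. \<bar>v z - slope_limit * \<Phi>_neg d z\<bar> \<le> \<epsilon> * norm z ^ d + B"
proof -
  obtain r0 where r0: "\<And>r \<beta>. r \<ge> r0 \<Longrightarrow> u (pt r \<beta>) \<le> slope_limit * (r ^ d * max 0 (sin \<beta>)) + \<epsilon> * r ^ d"
    using u_le_limit[OF assms] by (auto simp: eventually_at_top_linorder)
  have "compact (cball 0 (max 0 r0) :: complex set)" by simp
  then have "bounded (u ` cball 0 (max 0 r0))"
    by (intro compact_imp_bounded compact_continuous_image continuous_u)
  then obtain B where B: "B > 0" "\<And>z. norm z \<le> max 0 r0 \<Longrightarrow> \<bar>u z\<bar> \<le> B" by (auto simp: bounded_pos)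
  have U: "\<bar>u z - slope_limit * \<Phi>_pos d z\<bar> \<le> \<epsilon> * norm z ^ d + B" for z
  proof -
    obtain \<beta> where \<beta>: "z = pt (norm z) \<beta>" using sector_pt_exhaust[OF d] .
    have low: "slope_limit * \<Phi>_pos d z \<le> u z"
      using u_ge_limit[of "norm z" \<beta>] \<Phi>_pos_pt[of "norm z" \<beta>] \<beta> by simp
    have "\<Phi>_pos d z \<ge> 0" by (simp add: \<Phi>_pos_def)
    then have c0: "slope_limit * \<Phi>_pos d z \<ge> 0" using slope_limit_nonneg by simp
    have e0: "\<epsilon> * norm z ^ d \<ge> 0" using assms by simp
    show ?thesis
    proof (cases "norm z \<ge> r0")
      case True
      then have "u z \<le> slope_limit * \<Phi>_pos d z + \<epsilon> * norm z ^ d"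
        using r0[of "norm z" \<beta>] \<Phi>_pos_pt[of "norm z" \<beta>] \<beta> by simp
      then show ?thesis using low B(1) by linarith
    next
      case False
      then have "\<bar>u z\<bar> \<le> B" using B(2)[of z] by simp
      then show ?thesis using low c0 e0 by linarith
    qed
  qed
  moreover have "\<bar>v z - slope_limit * \<Phi>_neg d z\<bar> \<le> \<epsilon> * norm z ^ d + B" for z
  proof -
    obtain \<beta> where \<beta>: "z = pt (norm z) \<beta>" using sector_pt_exhaust[OF d] .
    have "v z = u (pt (norm z) (- \<beta>))" "\<Phi>_neg d z = \<Phi>_pos d (pt (norm z) (- \<beta>))"
      using \<beta> v_pt[of "norm z" \<beta>] \<Phi>_neg_pt[of "norm z" \<beta>] by auto
    then show ?thesis using U[of "pt (norm z) (- \<beta>)"] by (simp add: norm_sector_pt)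
  qed
  ultimately show thesis using B(1) by (intro that[of B]) auto
qed

lemma blowdown:
  assumes "compact K"
  shows "uniform_limit K
             (\<lambda>R x. (1 / R ^ d * u (R *\<^sub>R x), 1 / R ^ d * v (R *\<^sub>R x)))
             (\<lambda>x. (slope_limit * \<Phi>_pos d x, slope_limit * \<Phi>_neg d x))
             at_top"
proof (rule uniform_limitI)
  fix e :: real assume "e > 0"
  obtain M where M: "M > 0" "\<And>x. x \<in> K \<Longrightarrow> norm x \<le> M"
    using compact_imp_bounded[OF assms] by (auto simp: bounded_pos)
  define \<epsilon> where "\<epsilon> = e / (4 * M ^ d)"
  have "\<epsilon> > 0" using \<open>e > 0\<close> M by (simp add: \<epsilon>_def)
  then obtain B where B: "B \<ge> 0"
    "\<And>z. \<bar>u z - slope_limit * \<Phi>_pos d z\<bar> \<le> \<epsilon> * norm z ^ d + B"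
    "\<And>z. \<bar>v z - slope_limit * \<Phi>_neg d z\<bar> \<le> \<epsilon> * norm z ^ d + B"
    using asymptotic_profile by blast
  have "filterlim (\<lambda>R::real. R ^ d) at_top at_top"
    using d by (intro filterlim_pow_at_top filterlim_ident) auto
  then have "((\<lambda>R. B / R ^ d) \<longlongrightarrow> 0) at_top"
    by (intro tendsto_divide_0[OF tendsto_const] filterlim_at_top_imp_at_infinity)
  then have "\<forall>\<^sub>F R in at_top. B / R ^ d < e / 4" using \<open>e > 0\<close> by (intro order_tendstoD(2)) auto
  then show "\<forall>\<^sub>F R in at_top. \<forall>x\<in>K. dist (1 / R ^ d * u (R *\<^sub>R x), 1 / R ^ d * v (R *\<^sub>R x))
      (slope_limit * \<Phi>_pos d x, slope_limit * \<Phi>_neg d x) < e"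
    using eventually_gt_at_top[of 0]
  proof eventually_elim
    case (elim R)
    have Rd: "R ^ d > 0" using elim by simp
    show ?case
    proof
      fix x assume x: "x \<in> K"
      have comp: "\<bar>1 / R ^ d * f - slope_limit * \<phi>\<bar> < e / 2"
        if "\<bar>f - slope_limit * (R ^ d * \<phi>)\<bar> \<le> \<epsilon> * norm (R *\<^sub>R x) ^ d + B" for f \<phi>
      proof -
        have "1 / R ^ d * f - slope_limit * \<phi> = (f - slope_limit * (R ^ d * \<phi>)) / R ^ d"
          using elim(2) by (simp add: diff_divide_distrib)
        then have "\<bar>1 / R ^ d * f - slope_limit * \<phi>\<bar> = \<bar>f - slope_limit * (R ^ d * \<phi>)\<bar> / R ^ d"
          using Rd by simp
        also have "\<dots> \<le> (\<epsilon> * norm (R *\<^sub>R x) ^ d + B) / R ^ d"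
          using that Rd by (intro divide_right_mono) auto
        also have "\<dots> = \<epsilon> * norm x ^ d + B / R ^ d"
          using elim by (simp add: power_mult_distrib add_divide_distrib)
        also have "\<epsilon> * norm x ^ d \<le> \<epsilon> * M ^ d"
          using M(2)[OF x] \<open>\<epsilon> > 0\<close> by (intro mult_left_mono power_mono) auto
        also have "\<epsilon> * M ^ d = e / 4" using M by (simp add: \<epsilon>_def)
        finally show ?thesis using elim(1) by linarith
      qed
      have \<Phi>R: "\<Phi> d (R *\<^sub>R x) = R ^ d * \<Phi> d x"
        by (simp add: \<Phi>_def scaleR_conv_of_real power_mult_distrib flip: of_real_power)
      have "\<Phi>_pos d (R *\<^sub>R x) = R ^ d * \<Phi>_pos d x" "\<Phi>_neg d (R *\<^sub>R x) = R ^ d * \<Phi>_neg d x"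
        using Rd by (simp_all add: \<Phi>_pos_def \<Phi>_neg_def \<Phi>R max_mult_distrib_left)
      then have uv: "\<bar>1 / R ^ d * u (R *\<^sub>R x) - slope_limit * \<Phi>_pos d x\<bar> < e / 2"
        "\<bar>1 / R ^ d * v (R *\<^sub>R x) - slope_limit * \<Phi>_neg d x\<bar> < e / 2"
        using comp B(2)[of "R *\<^sub>R x"] B(3)[of "R *\<^sub>R x"] by simp_all
      have "dist (1 / R ^ d * u (R *\<^sub>R x), 1 / R ^ d * v (R *\<^sub>R x)) (slope_limit * \<Phi>_pos d x, slope_limit * \<Phi>_neg d x) \<le>
          \<bar>1 / R ^ d * u (R *\<^sub>R x) - slope_limit * \<Phi>_pos d x\<bar> + \<bar>1 / R ^ d * v (R *\<^sub>R x) - slope_limit * \<Phi>_neg d x\<bar>"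
        unfolding dist_prod_def fst_conv snd_conv dist_real_def by (rule sqrt_sum_squares_le_sum) auto
      then show "dist (1 / R ^ d * u (R *\<^sub>R x), 1 / R ^ d * v (R *\<^sub>R x))
          (slope_limit * \<Phi>_pos d x, slope_limit * \<Phi>_neg d x) < e"
        using uv by linarith
    qed
  qed
qed

end

theorem corollary1p5:
  fixes d :: nat and u v :: "complex \<Rightarrow> real"
  assumes "d \<ge> 1"
    and "positive_solution u v"
    and "\<And>z. \<Phi> d z > 0 \<Longrightarrow> u z - v z > 0"
    and "\<And>z. \<Phi> d z < 0 \<Longrightarrow> u z - v z < 0"
    and "\<And>z. u z \<ge> \<Phi>_pos d z"
    and "\<And>z. v z \<ge> \<Phi>_neg d z"
    and "\<And>L z. L \<in> nodal_lines d \<Longrightarrow> u (reflection L z) = v z"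
    and "\<And>r. r > 0 \<Longrightarrow> almgren u v r \<le> real d"
    and "(almgren u v \<longlongrightarrow> real d) at_top"
  shows "\<exists>c::real. \<forall>K. compact K \<longrightarrow>
           uniform_limit K
             (\<lambda>R x. (1 / R ^ d * u (R *\<^sub>R x), 1 / R ^ d * v (R *\<^sub>R x)))
             (\<lambda>x. (c * \<Phi>_pos d x, c * \<Phi>_neg d x))
             at_top"
proof -
  interpret symmetric_solution d u v
    using assms(1-3,7) by unfold_locales auto
  show ?thesis using blowdown by blast
qed

end
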